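(* Let $d\in\mathbb{N}$, let $R(z)=\sum_{j=1}^{d}\frac{a_j}{z-p_j}$ be a $d$-good rational function, let $i\in\{1,\dots,d\}$, and let $K_i$ be the connected component of $\{z\in\hat{\mathbb{C}}:|R(z)|\ge 1\}$ containing $p_i$. Suppose that, for some $r>1$, \[ \Big\{z\in\hat{\mathbb{C}}:|z|\ge\frac1r\Big\}\subset R(V_i), \] where $V_i$ is a neighborhood of $K_i$ and $R$ is injective on $V_i$. Then \[ \mathrm{cap}(K_i)\le\frac{r^{6}}{(r^{2}-1)(r-1)^{4}}\,|a_i| . \]
   Context: $\mathbb{D}=\{z\in\mathbb{C}:|z|<1\}$ and $\hat{\mathbb{C}}$ is the extended complex plane. A rational function $R$ is called $d$-good ($d\in\mathbb{N}$) if it has degree $d$, $R(\infty)=0$, and the open set $\Omega:=R^{-1}(\mathbb{D})\subset\hat{\mathbb{C}}$ is connected and bounded by $d$ disjoint analytic Jordan curves $\gamma_1,\dots,\gamma_d$. In that case $R$ has exactly one pole $p_i$, which is simple, in the bounded component of $\hat{\mathbb{C}}\setminus\gamma_i$ for each $i$, and $R(z)=\sum_{i=1}^{d}\frac{a_i}{z-p_i}$ for some $a_i\in\mathbb{C}\setminus\{0\}$. The logarithmic capacity of a compact set $E\subset\mathbb{C}$ is $\mathrm{cap}(E)=e^{-I(E)}$, where $I(E)=\inf_\mu\iint\log\frac{1}{|z-w|}\,d\mu(z)\,d\mu(w)$, the infimum being over all Borel probability measures $\mu$ supported on $E$. *)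

theory Defs
  imports "HOL-Complex_Analysis.Complex_Analysis" "HOL-Probability.Probability"
begin

text \<open>
  The extended complex plane is the one-point compactification of \<open>\<complex>\<close>:
  \<^term>\<open>None\<close> is the point at infinity and \<open>Some z\<close> is the finite point \<open>z\<close>.
\<close>

abbreviation ext_plane :: "complex option topology" where
  "ext_plane \<equiv> Alexandroff_compactification euclidean"

fun ext_norm :: "complex option \<Rightarrow> ereal" where
  "ext_norm (Some z) = ereal (norm z)"
| "ext_norm None = \<infinity>"

text \<open>
  The self-map of the extended plane induced by \<open>P / Q\<close>, meaningful for coprime \<open>P\<close>, \<open>Q\<close>.
  The value at infinity is the limit of \<open>P z / Q z\<close>; in particular it is \<open>0\<close> when
  \<open>degree P < degree Q\<close>, because then \<open>coeff P (degree Q) = 0\<close>.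
\<close>

fun quotient_map_ext :: "complex poly \<Rightarrow> complex poly \<Rightarrow> complex option \<Rightarrow> complex option" where
  "quotient_map_ext P Q (Some z) = (if poly Q z = 0 then None else Some (poly P z / poly Q z))"
| "quotient_map_ext P Q None =
     (if degree P > degree Q then None else Some (coeff P (degree Q) / lead_coeff Q))"

definition rational_of_degree :: "nat \<Rightarrow> (complex option \<Rightarrow> complex option) \<Rightarrow> bool" where
  "rational_of_degree d R \<longleftrightarrow>
     (\<exists>P Q. Q \<noteq> 0 \<and> coprime P Q \<and> max (degree P) (degree Q) = d \<and> R = quotient_map_ext P Q)"

definition analytic_jordan_curve :: "complex set \<Rightarrow> bool" where
  "analytic_jordan_curve \<Gamma> \<longleftrightarrow>
     (\<exists>f U. open U \<and> sphere 0 1 \<subseteq> U \<and> f holomorphic_on U \<and> inj_on f U \<and> \<Gamma> = f ` sphere 0 1)"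

text \<open>
  Since \<open>R \<infinity> = 0\<close>, infinity is interior to \<open>\<Omega>\<close>, so the bounding curves lie in
  the finite plane. Openness of \<open>\<Omega>\<close> is automatic, as rational maps are continuous.
\<close>

definition good :: "nat \<Rightarrow> (complex option \<Rightarrow> complex option) \<Rightarrow> bool" where
  "good d R \<longleftrightarrow>
     rational_of_degree d R \<and> R None = Some 0 \<and>
     (let \<Omega> = {x. ext_norm (R x) < 1} in
        connectedin ext_plane \<Omega> \<and>
        (\<exists>\<gamma>. (\<forall>j\<in>{1..d}. analytic_jordan_curve (\<gamma> j)) \<and>
             disjoint_family_on \<gamma> {1..d} \<and>
             ext_plane frontier_of \<Omega> = (\<Union>j\<in>{1..d}. Some ` \<gamma> j)))"

definition log_kernel :: "complex \<times> complex \<Rightarrow> ereal" where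
  "log_kernel = (\<lambda>(z, w). if z = w then \<infinity> else ereal (ln (1 / norm (z - w))))"

text \<open>
  The kernel takes both signs and the value \<open>\<infinity>\<close>, so its integral is formed as the integral
  of the positive part minus that of the negative part (\<^const>\<open>e2ennreal\<close> sends negative
  numbers to \<open>0\<close>). For a compactly supported probability measure the kernel is bounded below
  almost everywhere, so the subtracted integral is finite.
\<close>

definition log_energy :: "complex measure \<Rightarrow> ereal" where
  "log_energy \<mu> =
     enn2ereal (\<integral>\<^sup>+ x. e2ennreal (log_kernel x) \<partial>(\<mu> \<Otimes>\<^sub>M \<mu>))
   - enn2ereal (\<integral>\<^sup>+ x. e2ennreal (- log_kernel x) \<partial>(\<mu> \<Otimes>\<^sub>M \<mu>))"

definition prob_measures_on :: "complex set \<Rightarrow> complex measure set" where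
  "prob_measures_on E = {\<mu>. prob_space \<mu> \<and> sets \<mu> = sets borel \<and> emeasure \<mu> E = 1}"

definition min_energy :: "complex set \<Rightarrow> ereal" where
  "min_energy E = (INF \<mu>\<in>prob_measures_on E. log_energy \<mu>)"

text \<open>
  Intended for compact \<open>E\<close>, where \<open>min_energy E > -\<infinity>\<close>; the first case is
  \<open>exp (-\<infinity>) = 0\<close>.
\<close>

definition log_capacity :: "complex set \<Rightarrow> real" where
  "log_capacity E = (if min_energy E = \<infinity> then 0 else exp (- real_of_ereal (min_energy E)))"

end

theory Submission
  imports Defs "HOL-Computational_Algebra.Field_as_Ring" "HOL-Computational_Algebra.Polynomial_Factorial"
begin

text \<open>
  On \<open>V\<close> the function \<open>1 / R\<close> is injective, vanishes at \<open>p\<^sub>i\<close> with derivative \<open>1 / a\<^sub>i\<close>, and covers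
  the disc of radius \<open>r\<close>. Its inverse \<open>h\<close> is univalent on that disc, \<open>h' 0 = a\<^sub>i\<close>, and maps the closed
  unit disc onto a set containing \<open>K\<^sub>i\<close>. A growth theorem for univalent functions therefore places
  \<open>K\<^sub>i\<close> in a disc about \<open>p\<^sub>i\<close>, and the capacity of a subset of a disc is at most its radius.
  This radius is already below the claimed bound, which leaves so much room that
  \<open>\<bar>f'' 0\<bar> \<le> 6 \<bar>f' 0\<bar>\<close> can replace Bieberbach's sharp constant 4. The weaker inequality follows from
  an area argument for the cube root transform \<open>z \<mapsto> (f (z\<^sup>3))\<^bsup>1/3\<^esup>\<close>, in which the outer
  boundary curve is enclosed by a circle; for the usual square root transform it would have to be
  approximated by an ellipse.
\<close>

unbundle no fps_syntax

subsection \<open>Area and the second coefficient of univalent functions\<close>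

text \<open>Change of variables is available on \<open>real^2\<close>, Fubini on
  \<open>real \<times> real\<close>. The linear bijection \<open>g\<close> maps boxes to boxes of
  equal volume and so transports the integral.\<close>

lemma integral_vec2_iterated:
  fixes f :: "real^2 \<Rightarrow> real"
  assumes "continuous_on (cbox (vector [a, c]) (vector [b, d])) f"
  shows "integral (cbox (vector [a, c]) (vector [b, d])) f
         = integral {a..b} (\<lambda>x. integral {c..d} (\<lambda>y. f (vector [x, y])))"
proof -
  define g :: "real \<times> real \<Rightarrow> real^2" where "g = (\<lambda>z. vector [fst z, snd z])"
  define h :: "real^2 \<Rightarrow> real \<times> real" where "h = (\<lambda>v. (v$1, v$2))"
  have hg: "h (g x) = x" for x by (simp add: h_def g_def)
  have gh: "g (h x) = x" for x by (simp add: h_def g_def vec_eq_iff forall_2)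
  have cont_g: "continuous_on A g" for A
    unfolding g_def
    by (intro linear_continuous_on, subst linear_conv_bounded_linear[symmetric], intro linearI)
       (auto simp: vec_eq_iff forall_2)
  have im_g: "g ` cbox u v = cbox (g u) (g v)" for u v
  proof -
    have "g ` cbox u v = {x. h x \<in> cbox u v}"
      using hg gh by (auto simp: image_iff) (metis gh)
    also have "\<dots> = cbox (g u) (g v)"
      by (cases u; cases v) (auto simp: h_def g_def mem_box_cart forall_2)
    finally show ?thesis .
  qed
  have im_h: "h ` cbox u v = cbox (h u) (h v)" for u v
    by (metis (no_types, lifting) gh hg im_g image_cong image_ident image_image)
  have content: "measure lborel (g ` cbox u v) = 1 * measure lborel (cbox u v)" for u v
  proof (cases "cbox u v = {}")
    case False
    then have "cbox (g u) (g v) \<noteq> {}" using im_g by (metis image_is_empty)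
    then have "measure lborel (cbox (g u) (g v)) = (\<Prod>i\<in>UNIV. g v $ i - g u $ i)"
      by (rule content_cbox_cart)
    also have "\<dots> = (fst v - fst u) * (snd v - snd u)"
      by (simp add: UNIV_2 g_def)
    also have "\<dots> = measure lborel (cbox u v)"
      using False content_Pair[of "fst u" "snd u" "fst v" "snd v"] by (auto simp: box_ne_empty Basis_prod_def inner_prod_def)
    finally show ?thesis by (simp add: im_g)
  qed simp
  let ?B = "cbox (vector [a, c]) (vector [b, d]) :: (real^2) set"
  have "(f has_integral integral ?B f) ?B"
    using assms by (simp add: integrable_continuous integrable_integral)
  then have "((\<lambda>x. f (g x)) has_integral (1 / 1) *\<^sub>R integral ?B f) (h ` ?B)"
    by (rule has_integral_twiddle[OF zero_less_one hg gh _ _ _ content, rotated 3])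
       (use im_g im_h cont_g[of UNIV] continuous_on_eq_continuous_at[OF open_UNIV, of g] in blast)+
  moreover have hB: "h ` ?B = cbox (a, c) (b, d)"
    by (simp add: im_h) (simp add: h_def)
  ultimately have "integral ?B f = integral (cbox (a, c) (b, d)) (\<lambda>x. f (g x))"
    by (simp add: integral_unique)
  also have "\<dots> = integral (cbox a b) (\<lambda>x. integral (cbox c d) (\<lambda>y. f (g (x, y))))"
  proof (rule integral_prod_continuous)
    have "g ` cbox (a, c) (b, d) = ?B" by (simp add: im_g) (simp add: g_def)
    then show "continuous_on (cbox (a, c) (b, d)) (\<lambda>x. f (g x))"
      using assms by (intro continuous_on_compose2[OF assms cont_g]) auto
  qed
  finally show ?thesis by (simp add: g_def)
qed

text \<open>The Jacobian determinant of \<open>G\<close> is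
  \<open>(norm (deriv G z))\<^sup>2\<close>, so by injectivity the integral is the area of the
  image, which lies in the disc of radius \<open>M\<close>. Injectivity is asked on the open
  rectangle only, since in the application the periodicity of \<open>exp\<close> identifies two
  edges.\<close>

lemma area_integral_le:
  fixes G :: "complex \<Rightarrow> complex"
  assumes U: "open U" and sub: "\<And>x y. x \<in> {a..b} \<Longrightarrow> y \<in> {c..d} \<Longrightarrow> Complex x y \<in> U"
    and hol: "G holomorphic_on U"
    and inj: "inj_on G {z. a < Re z \<and> Re z < b \<and> c < Im z \<and> Im z < d}"
    and bound: "\<And>z. a < Re z \<Longrightarrow> Re z < b \<Longrightarrow> c < Im z \<Longrightarrow> Im z < d \<Longrightarrow> norm (G z) \<le> M"
    and M: "0 \<le> M"
  shows "integral {a..b} (\<lambda>x. integral {c..d} (\<lambda>y. (norm (deriv G (Complex x y)))\<^sup>2)) \<le> pi * M\<^sup>2"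
proof -
  define T :: "real^2 \<Rightarrow> complex" where "T = (\<lambda>v. Complex (v$1) (v$2))"
  define T' :: "complex \<Rightarrow> real^2" where "T' = (\<lambda>z. vector [Re z, Im z])"
  have TT': "T (T' z) = z" for z by (simp add: T_def T'_def)
  have T'T: "T' (T v) = v" for v by (simp add: T_def T'_def vec_eq_iff forall_2)
  have linT: "bounded_linear T"
    unfolding T_def linear_conv_bounded_linear[symmetric]
    by (intro linearI) (auto simp: complex_eq_iff)
  have linT': "bounded_linear T'"
    unfolding T'_def linear_conv_bounded_linear[symmetric]
    by (intro linearI) (auto simp: vec_eq_iff forall_2)
  let ?S = "box (vector [a, c]) (vector [b, d]) :: (real^2) set"
  let ?B = "cbox (vector [a, c]) (vector [b, d]) :: (real^2) set"
  have memS: "v \<in> ?S \<longleftrightarrow> a < Re (T v) \<and> Re (T v) < b \<and> c < Im (T v) \<and> Im (T v) < d" for v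
    by (auto simp: mem_box_cart forall_2 T_def)
  have memB: "v \<in> ?B \<Longrightarrow> T v \<in> U" for v
    by (auto simp: mem_box_cart forall_2 T_def intro!: sub)
  define F where "F = (\<lambda>v. T' (G (T v)))"
  define F' where "F' = (\<lambda>v h. T' (deriv G (T v) * T h))"
  have der: "(F has_derivative F' v) (at v within ?S)" if "v \<in> ?S" for v
  proof -
    have "T v \<in> U" using that memB box_subset_cbox by blast
    then have "(G has_derivative (*) (deriv G (T v))) (at (T v))"
      using hol U holomorphic_derivI has_field_derivative_def by blast
    moreover have "(T has_derivative T) (at v)" "\<And>z. (T' has_derivative T') (at z)"
      using linT linT' by (auto intro: bounded_linear_imp_has_derivative)
    ultimately have "((\<lambda>v. T' (G (T v))) has_derivative (\<lambda>h. T' (deriv G (T v) * T h))) (at v)"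
      using has_derivative_compose by metis
    then show ?thesis unfolding F_def F'_def by (rule has_derivative_at_withinI)
  qed
  have det: "\<bar>det (matrix (F' v))\<bar> = (norm (deriv G (T v)))\<^sup>2" for v
    by (simp add: F'_def det_2 matrix_def T_def T'_def axis_def cmod_power2 flip: power2_eq_square)
  have injF: "inj_on F ?S"
  proof (rule inj_onI)
    fix u v assume uv: "u \<in> ?S" "v \<in> ?S" "F u = F v"
    then have "G (T u) = G (T v)" unfolding F_def by (metis TT')
    with uv have "T u = T v" using inj by (auto simp: inj_on_def memS)
    then show "u = v" by (metis T'T)
  qed
  have contd: "continuous_on ?B (\<lambda>v. (norm (deriv G (T v)))\<^sup>2)"
  proof -
    have "deriv G holomorphic_on U" using hol U by (rule holomorphic_deriv)
    then have "continuous_on ?B (\<lambda>v. deriv G (T v))"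
      by (intro continuous_on_compose2[OF holomorphic_on_imp_continuous_on, of "deriv G" U]
          bounded_linear.continuous_on[OF linT] continuous_on_id) (use memB in auto)
    then show ?thesis by (intro continuous_intros)
  qed
  then have "(\<lambda>v. (norm (deriv G (T v)))\<^sup>2) integrable_on ?B" by (rule integrable_continuous)
  then have int: "(\<lambda>v. (norm (deriv G (T v)))\<^sup>2) integrable_on ?S"
    by (simp add: integrable_on_open_interval)
  have S: "?S \<in> sets lebesgue" by simp
  have meas: "F ` ?S \<in> lmeasurable"
    using measurable_differentiable_image_eq[OF S der injF] int det by simp
  have "integral {a..b} (\<lambda>x. integral {c..d} (\<lambda>y. (norm (deriv G (Complex x y)))\<^sup>2))
      = integral ?B (\<lambda>v. (norm (deriv G (T v)))\<^sup>2)"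
    by (subst integral_vec2_iterated[OF contd]) (simp add: T_def)
  also have "\<dots> = integral ?S (\<lambda>v. (norm (deriv G (T v)))\<^sup>2)"
    by (simp add: integral_open_interval)
  also have "\<dots> = measure lebesgue (F ` ?S)"
    using measure_differentiable_image_eq[OF S der injF] int det by simp
  also have "\<dots> \<le> measure lebesgue (cball (0::real^2) M)"
  proof (rule measure_mono_fmeasurable)
    show "F ` ?S \<subseteq> cball 0 M"
    proof clarify
      fix v assume v: "v \<in> ?S"
      have "norm (F v) = norm (G (T v))"
        by (simp add: F_def T'_def norm_vec_def L2_set_def UNIV_2 cmod_def)
      then show "F v \<in> cball 0 M" using bound v memS by auto
    qed
  qed (use meas in auto)
  also have "\<dots> = pi * M\<^sup>2"
    using content_cball[OF M, of "0::real^2"] by (simp add: unit_ball_vol_2)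
  finally show ?thesis .
qed

section \<open>Means over circles\<close>

lemma circle_mean_value:
  fixes f :: "complex \<Rightarrow> complex" and R \<rho> :: real
  assumes "f holomorphic_on ball 0 R" "0 < \<rho>" "\<rho> < R"
  shows "((\<lambda>y. f (\<rho> * exp (\<i> * y))) has_integral 2 * pi * f 0) {0..2 * pi}"
proof -
  have "((\<lambda>u. f u / (u - 0)) has_contour_integral (2 * of_real pi * \<i> * f 0)) (circlepath 0 \<rho>)"
  proof (rule Cauchy_integral_circlepath_simple)
    show "f holomorphic_on cball 0 \<rho>"
      using assms by (auto intro: holomorphic_on_subset)
  qed (use assms in auto)
  then have "((\<lambda>t. f (0 + \<rho> * cis t) / (0 + \<rho> * cis t - 0) * \<rho> * \<i> * cis t) has_integral
       2 * of_real pi * \<i> * f 0) {0..2 * pi}"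
    unfolding circlepath_def
    by (subst (asm) has_contour_integral_part_circlepath_iff) auto
  moreover have "f (0 + \<rho> * cis t) / (0 + \<rho> * cis t - 0) * \<rho> * \<i> * cis t
       = \<i> * f (\<rho> * exp (\<i> * t))" for t :: real
    using assms by (simp add: cis_conv_exp field_simps)
  ultimately have "((\<lambda>t. \<i> * f (\<rho> * exp (\<i> * t))) has_integral 2 * of_real pi * \<i> * f 0) {0..2 * pi}"
    by (elim has_integral_eq[rotated])
  from has_integral_mult_right[OF this, of "-\<i>"] show ?thesis
    by (simp add: algebra_simps)
qed

text \<open>Bessel's inequality: of the weighted squared Taylor coefficients of
  \<open>c + z ^ k * h z\<close> that Parseval's identity would sum, only those of index 0 and
  \<open>k\<close> are kept.\<close>

lemma circle_bessel:
  fixes h :: "complex \<Rightarrow> complex" and R \<rho> :: real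
  assumes h: "h holomorphic_on ball 0 R" and \<rho>: "0 < \<rho>" "\<rho> < R" and k: "0 < k"
  shows "2 * pi * ((norm c)\<^sup>2 + \<rho> ^ (2 * k) * (norm (h 0))\<^sup>2)
    \<le> integral {0..2 * pi} (\<lambda>y. (norm (c + (\<rho> * exp (\<i> * of_real y)) ^ k * h (\<rho> * exp (\<i> * of_real y))))\<^sup>2)"
proof -
  \<comment> \<open>\<open>Re \<Psi>\<close> is a minorant of the integrand whose mean is computed by the mean value property.\<close>
  define \<Psi> where "\<Psi> = (\<lambda>z. of_real ((norm c)\<^sup>2) + 2 * cnj c * (z ^ k * h z)
      + of_real (\<rho> ^ (2 * k)) * (2 * (cnj (h 0) * h z) - of_real ((norm (h 0))\<^sup>2)))"
  let ?z = "\<lambda>y::real. \<rho> * exp (\<i> * of_real y)"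
  have "\<Psi> holomorphic_on ball 0 R"
    unfolding \<Psi>_def using h by (intro holomorphic_intros)
  from circle_mean_value[OF this \<rho>]
  have *: "((\<lambda>y. Re (\<Psi> (?z y))) has_integral Re (2 * pi * \<Psi> 0)) {0..2 * pi}"
    by (rule has_integral_Re)
  have "cnj (h 0) * h 0 = of_real ((norm (h 0))\<^sup>2)"
    by (metis complex_norm_square mult.commute)
  then have "\<Psi> 0 = of_real ((norm c)\<^sup>2 + \<rho> ^ (2 * k) * (norm (h 0))\<^sup>2)"
    using zero_power[OF k, where 'a=complex] by (simp add: \<Psi>_def)
  then have int: "((\<lambda>y. Re (\<Psi> (?z y))) has_integral 2 * pi * ((norm c)\<^sup>2 + \<rho> ^ (2 * k) * (norm (h 0))\<^sup>2)) {0..2 * pi}"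
  proof -
    have "2 * pi * \<Psi> 0 = complex_of_real (2 * pi * ((norm c)\<^sup>2 + \<rho> ^ (2 * k) * (norm (h 0))\<^sup>2))"
      unfolding \<open>\<Psi> 0 = _\<close> by simp
    then show ?thesis using * by (simp only: Re_complex_of_real)
  qed
  have conth: "continuous_on {0..2 * pi} (\<lambda>y. h (?z y))"
    by (intro continuous_on_compose2[OF holomorphic_on_imp_continuous_on[OF h]] continuous_intros)
      (use \<rho> in \<open>auto simp: norm_mult\<close>)
  have "(\<lambda>y. (norm (c + ?z y ^ k * h (?z y)))\<^sup>2) integrable_on {0..2 * pi}"
    by (intro integrable_continuous_interval continuous_intros conth)
  moreover have "Re (\<Psi> (?z y)) \<le> (norm (c + ?z y ^ k * h (?z y)))\<^sup>2" for y
  proof -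
    define w where "w = ?z y ^ k * h (?z y)"
    have "norm (?z y ^ k) = \<rho> ^ k" using \<rho> by (simp add: norm_mult norm_power)
    then have w: "(norm w)\<^sup>2 = \<rho> ^ (2 * k) * (norm (h (?z y)))\<^sup>2"
      by (simp add: w_def norm_mult power_mult_distrib power_mult[symmetric] mult.commute)
    have sq: "(norm (u + v))\<^sup>2 = (norm u)\<^sup>2 + 2 * Re (cnj u * v) + (norm v)\<^sup>2" for u v :: complex
      unfolding cmod_power2 by (simp add: power2_eq_square algebra_simps)
    \<comment> \<open>Expanding \<open>0 \<le> (norm (h z - h 0))\<^sup>2\<close> bounds the square
      below by an expression affine in \<open>h z\<close>, hence by the real part of a holomorphic
      function.\<close>
    have "2 * Re (cnj (h 0) * h (?z y)) - (norm (h 0))\<^sup>2 \<le> (norm (h (?z y)))\<^sup>2"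
      using sq[of "- h 0" "h (?z y)"] zero_le_power2[of "norm (- h 0 + h (?z y))"] by simp
    then have "\<rho> ^ (2 * k) * (2 * Re (cnj (h 0) * h (?z y)) - (norm (h 0))\<^sup>2) \<le> (norm w)\<^sup>2"
      unfolding w using \<rho> by (intro mult_left_mono) auto
    moreover have "Re (\<Psi> (?z y)) = (norm c)\<^sup>2 + 2 * Re (cnj c * w)
        + \<rho> ^ (2 * k) * (2 * Re (cnj (h 0) * h (?z y)) - (norm (h 0))\<^sup>2)"
    proof -
      have "\<Psi> (?z y) = of_real ((norm c)\<^sup>2) + of_real 2 * (cnj c * w)
        + of_real (\<rho> ^ (2 * k)) * (of_real 2 * (cnj (h 0) * h (?z y)) - of_real ((norm (h 0))\<^sup>2))"
        unfolding \<Psi>_def w_def by simp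
      then show ?thesis
        by (simp only: Re_complex_of_real Im_complex_of_real plus_complex.sel minus_complex.sel
            times_complex.sel mult_zero_left diff_zero)
    qed
    ultimately show ?thesis unfolding sq w_def[symmetric] by linarith
  qed
  ultimately show ?thesis
    by (intro has_integral_le[OF int integrable_integral])
qed

section \<open>The cube root transform and the second coefficient\<close>

text \<open>The singularity at 0 is removable. The factorisation holds for every \<open>z\<close>,
  also outside the disc, because \<open>q\<close> is the same quotient everywhere.\<close>

lemma holomorphic_difference_quotient:
  fixes f :: "complex \<Rightarrow> complex" and R :: real
  assumes "f holomorphic_on ball 0 R" "0 < R"
  obtains q where "q holomorphic_on ball 0 R" "\<And>z. f z = f 0 + z * q z" "q 0 = deriv f 0"
proof -
  have "(\<lambda>z. if z = 0 then deriv f 0 else (f z - f 0) / (z - 0)) holomorphic_on ball 0 R"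
    by (rule pole_lemma) (use assms in auto)
  then show thesis by (rule that) auto
qed

text \<open>
  Writing \<open>p z = (z / f z)\<^bsup>1/3\<^esup>\<close>, the reciprocal of the cube root transform of \<open>f\<close> is
  \<open>p (z\<^sup>3) / z\<close>. In the coordinate \<open>z = exp u\<close>, the annulus \<open>\<delta> < \<bar>z\<bar> < 9/10\<close> becomes a rectangle, and
  its image lies in a disc of radius \<open>1 / \<delta> + O(\<delta>\<^sup>2)\<close>, whose area is \<open>\<pi> / \<delta>\<^sup>2 + O(\<delta>)\<close>; comparing areas
  as \<open>\<delta> \<rightarrow> 0\<close> gives the bound. Letting \<open>9/10\<close> tend to 1 would improve it to \<open>1 / sqrt 2\<close>.
\<close>
lemma cube_root_area_bound:
  fixes p :: "complex \<Rightarrow> complex"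
  assumes hol: "p holomorphic_on ball 0 1" and nz: "\<And>z. z \<in> ball 0 1 \<Longrightarrow> p z \<noteq> 0" and p0: "p 0 = 1"
    and inj: "inj_on (\<lambda>z. z / p z ^ 3) (ball 0 1)"
  shows "norm (deriv p 0) \<le> 1"
proof -
  obtain q where q: "q holomorphic_on ball 0 1" "\<And>z. p z = 1 + z * q z" "q 0 = deriv p 0"
    using holomorphic_difference_quotient[OF hol] p0 by auto
  have cube: "z ^ 3 \<in> ball 0 1" if "z \<in> ball 0 1" for z :: complex
    using that by (simp add: norm_power power_less_one_iff)
  have "continuous_on (cball 0 (1/2)) q"
    by (rule holomorphic_on_imp_continuous_on, rule holomorphic_on_subset[OF q(1)]) auto
  then have "bounded (q ` cball 0 (1/2))"
    by (intro compact_imp_bounded compact_continuous_image compact_cball)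
  \<comment> \<open>\<open>C\<close> controls the error term:
    \<open>p (z ^ 3) = 1 + z ^ 3 * q (z ^ 3)\<close> differs from 1 by at most
    \<open>C * \<delta> ^ 3\<close> when \<open>norm z = \<delta>\<close>.\<close>
  then obtain C where C: "\<And>z. z \<in> cball 0 (1/2) \<Longrightarrow> norm (q z) \<le> C" "0 < C"
    unfolding bounded_pos by blast
  define \<phi> where "\<phi> = (\<lambda>z. z / p (z ^ 3))"
  have \<phi>_hol: "\<phi> holomorphic_on ball 0 1"
    unfolding \<phi>_def using nz cube
    by (intro holomorphic_intros holomorphic_on_compose_gen[OF _ hol, unfolded o_def]) auto
  have \<phi>_inj: "inj_on \<phi> (ball 0 1)"
  proof (rule inj_onI)
    fix z w :: complex assume zw: "z \<in> ball 0 1" "w \<in> ball 0 1" "\<phi> z = \<phi> w"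
    then have "\<phi> z ^ 3 = \<phi> w ^ 3" by simp
    then have "z ^ 3 / p (z ^ 3) ^ 3 = w ^ 3 / p (w ^ 3) ^ 3"
      by (simp add: \<phi>_def power_divide)
    \<comment> \<open>Univalence determines the cube; then the denominators \<open>p (z ^ 3)\<close>
      and \<open>p (w ^ 3)\<close> agree, and so do the numerators.\<close>
    then have "z ^ 3 = w ^ 3" using inj cube zw by (auto simp: inj_on_def)
    then show "z = w" using zw nz cube unfolding \<phi>_def by (metis nonzero_divide_eq_eq nonzero_mult_div_cancel_right times_divide_eq_left)
  qed
  define G where "G = (\<lambda>u. exp (- u) * p (exp (3 * u)))"
  \<comment> \<open>With \<open>z = exp u\<close>, \<open>G\<close> expands as
    \<open>1 / z + deriv p 0 * z\<^sup>2 + ...\<close>, and differentiation in \<open>u\<close>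
    multiplies each power of \<open>z\<close> by its exponent. \<open>h\<close> is what follows
    \<open>- 1 / z\<close> in the result, divided by \<open>z\<^sup>2\<close>.\<close>
  define h where "h = (\<lambda>z. 3 * deriv p (z ^ 3) - q (z ^ 3))"
  have exp3: "exp (3 * u) = exp u ^ 3" for u :: complex
    by (metis exp_of_nat_mult of_nat_numeral)
  have \<phi>_exp: "\<phi> (exp u) = 1 / G u" for u
    unfolding \<phi>_def G_def exp3 by (simp add: exp_minus field_simps)
  have exp_ball: "exp u \<in> ball 0 1" if "Re u < 0" for u
    using that by simp
  have der_G: "(G has_field_derivative exp (- u) * (-1 + exp u ^ 3 * h (exp u))) (at u)"
    if "Re u < 0" for u
  proof -
    have "exp (3 * u) \<in> ball 0 1" using that by simp
    then have "(p has_field_derivative deriv p (exp (3 * u))) (at (exp (3 * u)))"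
      by (intro holomorphic_derivI[OF hol]) auto
    then have "((\<lambda>u. p (exp (3 * u))) has_field_derivative deriv p (exp (3 * u)) * (exp (3 * u) * 3)) (at u)"
      by (rule DERIV_chain2) (auto intro!: derivative_eq_intros)
    then have "(G has_field_derivative - exp (- u) * p (exp (3 * u)) + exp (- u) * (deriv p (exp (3 * u)) * (exp (3 * u) * 3))) (at u)"
      unfolding G_def by (auto intro!: derivative_eq_intros)
    moreover have "p (exp (3 * u)) = 1 + exp u ^ 3 * q (exp u ^ 3)"
      using q(2)[of "exp u ^ 3"] by (simp only: exp3)
    then have "- exp (- u) * p (exp (3 * u)) + exp (- u) * (deriv p (exp (3 * u)) * (exp (3 * u) * 3))
        = exp (- u) * (-1 + exp u ^ 3 * h (exp u))"
      unfolding h_def exp3 by (simp add: algebra_simps)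
    ultimately show ?thesis by simp
  qed
  have G_hol: "G holomorphic_on {u. Re u < 0}"
    using der_G by (auto simp: holomorphic_on_open open_halfspace_Re_lt)
  have h_hol: "h holomorphic_on ball 0 1"
    unfolding h_def using cube
    by (intro holomorphic_intros holomorphic_on_compose_gen[OF _ q(1), unfolded o_def] 
        holomorphic_on_compose_gen[OF _ holomorphic_deriv[OF hol open_ball], unfolded o_def]) auto
  have h0: "h 0 = 2 * deriv p 0" by (simp add: h_def q(3))
  let ?b = "norm (deriv p 0)"
  \<comment> \<open>The integral of \<open>(norm (deriv G u))\<^sup>2\<close> is bounded above by an
    area and below by \<open>circle_bessel\<close>. Both bounds contain
    \<open>pi / \<delta>\<^sup>2\<close>, which cancels; \<open>100/81\<close> is
    \<open>1 / (9/10)\<^sup>2\<close>.\<close>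
  have main: "2 * ?b\<^sup>2 * ((9/10)^4 - \<delta> ^ 4) \<le> 100/81 + 2 * C * \<delta> + C\<^sup>2 * \<delta> ^ 4"
    if \<delta>: "0 < \<delta>" "\<delta> < 1/2" for \<delta> :: real
  proof -
    define m where "m = \<delta> / (1 + C * \<delta> ^ 3)"
    have m: "0 < m" using \<delta> C by (simp add: m_def add_pos_pos)
    \<comment> \<open>On the circle of radius \<open>\<delta>\<close> the modulus of
      \<open>\<phi>\<close> is at least \<open>m\<close>, so the image of the inner disc covers
      \<open>ball 0 m\<close>. By injectivity the annulus is mapped outside that ball, and its image
      under \<open>1 / \<phi>\<close> lies in the disc of radius \<open>1 / m\<close>.\<close>
    have ball: "ball 0 m \<subseteq> \<phi> ` ball 0 \<delta>"
    proof -
      have "ball (\<phi> 0) m \<subseteq> \<phi> ` ball 0 \<delta>"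
      proof (rule ball_subset_open_map_image)
        show "continuous_on (closure (ball 0 \<delta>)) \<phi>"
          using \<delta> by (intro holomorphic_on_imp_continuous_on holomorphic_on_subset[OF \<phi>_hol]) auto
        show "open (\<phi> ` interior (ball 0 \<delta>))"
          using \<delta> by (auto intro!: open_mapping_thm3 holomorphic_on_subset[OF \<phi>_hol] inj_on_subset[OF \<phi>_inj])
        fix z assume "z \<in> frontier (ball (0::complex) \<delta>)"
        then have z: "norm z = \<delta>" using \<delta> by (simp add: frontier_ball)
        have "norm (z ^ 3) \<le> 1/2"
          using \<delta> power_decreasing[of 1 3 \<delta>] by (simp add: norm_power z)
        then have "norm (z ^ 3 * q (z ^ 3)) \<le> \<delta> ^ 3 * C"
          using C \<delta> by (auto simp: norm_mult norm_power z intro!: mult_left_mono)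
        then have "norm (p (z ^ 3)) \<le> 1 + C * \<delta> ^ 3"
          unfolding q(2)[of "z ^ 3"] using norm_triangle_ineq[of 1 "z ^ 3 * q (z ^ 3)"] by (simp add: mult.commute)
        moreover have "p (z ^ 3) \<noteq> 0" using nz cube[of z] z \<delta> by auto
        ultimately show "m \<le> norm (\<phi> z - \<phi> 0)"
          using \<delta> C by (auto simp: \<phi>_def m_def norm_divide z intro!: divide_left_mono mult_pos_pos add_pos_pos)
      qed (use \<delta> m in auto)
      then show ?thesis by (simp add: \<phi>_def)
    qed
    define x0 x1 where "x0 = ln \<delta>" and "x1 = ln (9/10::real)"
    have x: "x0 \<le> x1" "x1 < 0" using \<delta> by (auto simp: x0_def x1_def)
    have "integral {x0..x1} (\<lambda>x. integral {0..2*pi} (\<lambda>y. (norm (deriv G (Complex x y)))\<^sup>2)) \<le> pi * (1 / m)\<^sup>2"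
    proof (rule area_integral_le[OF open_halfspace_Re_lt _ G_hol])
      show "inj_on G {z. x0 < Re z \<and> Re z < x1 \<and> 0 < Im z \<and> Im z < 2 * pi}"
      proof (rule inj_onI, clarify)
        fix u v assume u: "x0 < Re u" "Re u < x1" "0 < Im u" "Im u < 2 * pi"
          and v: "x0 < Re v" "Re v < x1" "0 < Im v" "Im v < 2 * pi" and eq: "G u = G v"
        have "\<phi> (exp u) = \<phi> (exp v)" using eq \<phi>_exp[of u] \<phi>_exp[of v] by simp
        then have "exp u = exp v" using \<phi>_inj exp_ball x u v by (auto simp: inj_on_def)
        moreover have "\<bar>Im u - Im v\<bar> < 2 * pi" using u v by linarith
        ultimately show "u = v" by (rule exp_complex_eqI[rotated])
      qed
      fix z assume z: "x0 < Re z" "Re z < x1" "0 < Im z" "Im z < 2 * pi"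
      then have "\<delta> < norm (exp z)" using \<delta> by (simp add: x0_def) (metis exp_less_mono exp_ln)
      moreover have ez: "exp z \<in> ball 0 1" using z x by auto
      ultimately have "\<phi> (exp z) \<notin> \<phi> ` ball 0 \<delta>"
        using \<delta> by (subst inj_on_image_mem_iff[OF \<phi>_inj]) (auto simp del: norm_exp_eq_Re)
      then have "m \<le> norm (\<phi> (exp z))" using ball by (meson in_mono linorder_not_less mem_ball_0)
      moreover have "norm (G z) = 1 / norm (\<phi> (exp z))"
        by (simp add: \<phi>_exp norm_divide)
      ultimately show "norm (G z) \<le> 1 / m" using m by (simp add: frac_le)
    qed (use x m in auto)
    also have "pi * (1 / m)\<^sup>2 = pi * (1 / \<delta>\<^sup>2 + 2 * C * \<delta> + C\<^sup>2 * \<delta> ^ 4)"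
      using \<delta> C by (simp add: m_def field_simps eval_nat_numeral)
    finally have upper: "integral {x0..x1} (\<lambda>x. integral {0..2*pi} (\<lambda>y. (norm (deriv G (Complex x y)))\<^sup>2))
        \<le> pi * (1 / \<delta>\<^sup>2 + 2 * C * \<delta> + C\<^sup>2 * \<delta> ^ 4)" .
    \<comment> \<open>A primitive of the lower bound that \<open>circle_bessel\<close> gives on the
      circle of radius \<open>exp x\<close>; the coefficient 4 in its derivative comes from
      \<open>h 0 = 2 * deriv p 0\<close>.\<close>
    define E where "E = (\<lambda>x::real. 2 * pi * (- exp (- 2 * x) / 2 + ?b\<^sup>2 * exp (4 * x)))"
    have 1: "((\<lambda>x. 2 * pi * (exp (- 2 * x) + 4 * ?b\<^sup>2 * exp (4 * x))) has_integral E x1 - E x0) {x0..x1}"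
      unfolding E_def
      by (rule fundamental_theorem_of_calculus[OF x(1)])
        (auto simp flip: has_real_derivative_iff_has_vector_derivative intro!: derivative_eq_intros)
    have 2: "(\<lambda>x. integral {0..2*pi} (\<lambda>y. (norm (deriv G (Complex x y)))\<^sup>2)) integrable_on {x0..x1}"
    proof -
      have "deriv G holomorphic_on {u. Re u < 0}" by (intro holomorphic_deriv G_hol open_halfspace_Re_lt)
      then have "continuous_on {u. Re u < 0} (deriv G)" by (rule holomorphic_on_imp_continuous_on)
      then have "continuous_on ({x0..x1} \<times> cbox 0 (2*pi)) (\<lambda>z. deriv G (Complex (fst z) (snd z)))"
        using x by (rule_tac continuous_on_compose2) (auto intro!: continuous_intros simp: Complex_eq)
      then have "continuous_on ({x0..x1} \<times> cbox 0 (2*pi)) (\<lambda>(x, y). (norm (deriv G (Complex x y)))\<^sup>2)"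
        by (auto intro!: continuous_intros simp: case_prod_beta)
      then have "continuous_on {x0..x1} (\<lambda>x. integral (cbox 0 (2*pi)) (\<lambda>y. (norm (deriv G (Complex x y)))\<^sup>2))"
        by (rule integral_continuous_on_param)
      then show ?thesis by (simp add: integrable_continuous_interval)
    qed
    have 3: "2 * pi * (exp (- 2 * x) + 4 * ?b\<^sup>2 * exp (4 * x))
       \<le> integral {0..2*pi} (\<lambda>y. (norm (deriv G (Complex x y)))\<^sup>2)" if "x \<in> {x0..x1}" for x
    proof -
      have x': "x < 0" using that x by auto
      have "deriv G (Complex x y) = exp (- Complex x y) * (-1 + exp (Complex x y) ^ 3 * h (exp (Complex x y)))" for y
        using x' by (intro DERIV_imp_deriv der_G) auto
      moreover have "exp (Complex x y) = exp x * exp (\<i> * y)" for y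
        by (simp add: Complex_eq exp_add exp_of_real)
      ultimately have eq: "(norm (deriv G (Complex x y)))\<^sup>2 =
          exp (- 2 * x) * (norm (-1 + (exp x * exp (\<i> * of_real y)) ^ 3 * h (exp x * exp (\<i> * of_real y))))\<^sup>2" for y
        by (simp add: norm_mult power_mult_distrib exp_of_real exp_double[symmetric])
      have "2 * pi * ((norm (-1::complex))\<^sup>2 + exp x ^ (2 * 3) * (norm (h 0))\<^sup>2) \<le>
         integral {0..2 * pi} (\<lambda>y. (norm (-1 + (exp x * exp (\<i> * of_real y)) ^ 3 * h (exp x * exp (\<i> * of_real y))))\<^sup>2)"
        by (rule circle_bessel[OF h_hol]) (use x' in auto)
      then have "exp (- 2 * x) * (2 * pi * ((norm (-1::complex))\<^sup>2 + exp x ^ (2 * 3) * (norm (h 0))\<^sup>2)) \<le>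
         exp (- 2 * x) * integral {0..2 * pi} (\<lambda>y. (norm (-1 + (exp x * exp (\<i> * of_real y)) ^ 3 * h (exp x * exp (\<i> * of_real y))))\<^sup>2)"
        by (rule mult_left_mono) simp
      also have "\<dots> = integral {0..2*pi} (\<lambda>y. (norm (deriv G (Complex x y)))\<^sup>2)"
        by (simp only: eq integral_mult_right)
      finally have *: "exp (- 2 * x) * (2 * pi * ((norm (-1::complex))\<^sup>2 + exp x ^ (2 * 3) * (norm (h 0))\<^sup>2))
          \<le> integral {0..2*pi} (\<lambda>y. (norm (deriv G (Complex x y)))\<^sup>2)" .
      have "exp (- 2 * x) * exp x ^ (2 * 3) = exp (4 * x)"
        by (simp flip: exp_of_nat_mult exp_add)
      then have "exp (- 2 * x) * (2 * pi * ((norm (-1::complex))\<^sup>2 + exp x ^ (2 * 3) * (norm (h 0))\<^sup>2))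
         = 2 * pi * (exp (- 2 * x) + 4 * ?b\<^sup>2 * exp (4 * x))"
        by (simp add: h0 norm_mult power_mult_distrib algebra_simps)
      with * show ?thesis by (simp only:)
    qed
    have "E x1 - E x0 \<le> integral {x0..x1} (\<lambda>x. integral {0..2*pi} (\<lambda>y. (norm (deriv G (Complex x y)))\<^sup>2))"
      by (rule has_integral_le[OF 1 integrable_integral[OF 2] 3])
    moreover have "exp (4 * x0) = \<delta> ^ 4" "exp (4 * x1) = (9/10)^4"
      "exp (2 * x0) = \<delta>\<^sup>2" and x1: "exp (2 * x1) = (9/10)\<^sup>2"
      using \<delta> exp_of_nat_mult[of 4 x0] exp_of_nat_mult[of 4 x1] exp_of_nat_mult[of 2 x0] exp_of_nat_mult[of 2 x1]
      by (simp_all add: x0_def x1_def)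
    moreover have "exp (- (2 * x0)) = 1 / \<delta>\<^sup>2" "exp (- (2 * x1)) = 100/81"
      by (simp_all add: exp_minus inverse_eq_divide \<open>exp (2 * x0) = _\<close> x1 power2_eq_square)
    ultimately have "pi * (2 * ?b\<^sup>2 * ((9/10)^4 - \<delta> ^ 4)) \<le> pi * (100/81 + 2 * C * \<delta> + C\<^sup>2 * \<delta> ^ 4)"
      using upper by (simp add: E_def right_diff_distrib distrib_left)
    then show ?thesis by simp
  qed
  have "2 * ?b\<^sup>2 * ((9/10)^4 - 0 ^ 4) \<le> 100/81 + 2 * C * 0 + C\<^sup>2 * 0 ^ 4"
  proof (rule tendsto_le)
    show "((\<lambda>\<delta>. 2 * ?b\<^sup>2 * ((9/10)^4 - \<delta> ^ 4)) \<longlongrightarrow> 2 * ?b\<^sup>2 * ((9/10)^4 - 0 ^ 4)) (at_right 0)"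
      "((\<lambda>\<delta>. 100/81 + 2 * C * \<delta> + C\<^sup>2 * \<delta> ^ 4) \<longlongrightarrow> 100/81 + 2 * C * 0 + C\<^sup>2 * 0 ^ 4) (at_right 0)"
      by (intro tendsto_intros)+
    have "eventually (\<lambda>\<delta>. \<delta> \<in> {0<..<1/2::real}) (at_right 0)"
      by (rule eventually_at_right_real) simp
    then show "\<forall>\<^sub>F \<delta> in at_right 0. 2 * ?b\<^sup>2 * ((9/10)^4 - \<delta> ^ 4) \<le> 100/81 + 2 * C * \<delta> + C\<^sup>2 * \<delta> ^ 4"
      by eventually_elim (use main in auto)
  qed simp
  \<comment> \<open>The radius 9/10 is large enough because
    \<open>2 * (9/10) ^ 6 > 1\<close>.\<close>
  then have "?b\<^sup>2 \<le> 1" by (simp add: power_divide)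
  then show ?thesis by (simp add: power_le_one_iff)
qed

text \<open>With \<open>f z = f 0 + z * q z\<close> and \<open>g\<close> a logarithm of
  \<open>q\<close>, taking for \<open>p\<close> the cube root of \<open>q 0 / q\<close> makes
  \<open>z / p z ^ 3\<close> an affine copy of \<open>f\<close>. The area bound applies to
  \<open>deriv p 0 = - deriv g 0 / 3\<close>, and the second derivative of \<open>f\<close> at 0 is
  \<open>2 * deriv f 0 * deriv g 0\<close>.\<close>

lemma univalent_second_deriv_le:
  fixes f :: "complex \<Rightarrow> complex"
  assumes hol: "f holomorphic_on ball 0 1" and inj: "inj_on f (ball 0 1)"
  shows "norm (deriv (deriv f) 0) \<le> 6 * norm (deriv f 0)"
proof -
  obtain q where q: "q holomorphic_on ball 0 1" "\<And>z. f z = f 0 + z * q z" "q 0 = deriv f 0"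
    using holomorphic_difference_quotient[OF hol] by auto
  have "deriv f 0 \<noteq> 0"
    by (rule holomorphic_injective_imp_regular[OF hol _ inj]) auto
  \<comment> \<open>A zero of \<open>q\<close> at \<open>z \<noteq> 0\<close> would give
    \<open>f z = f 0\<close>; at 0 the value is \<open>deriv f 0\<close>.\<close>
  then have nz: "q z \<noteq> 0" if "z \<in> ball 0 1" for z
    using inj_onD[OF inj, of z 0] that q(2)[of z] q(3) by (cases "z = 0") auto
  obtain g where g: "g holomorphic_on ball 0 1" "\<And>z. z \<in> ball 0 1 \<Longrightarrow> exp (g z) = q z"
    using holomorphic_logarithm_exists[OF convex_ball open_ball q(1) nz, of 0] by auto
  define p where "p = (\<lambda>z. exp ((g 0 - g z) / 3))"
  have p_hol: "p holomorphic_on ball 0 1"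
    unfolding p_def using g(1) by (intro holomorphic_intros) auto
  have g0: "(g has_field_derivative deriv g 0) (at 0)"
    by (rule holomorphic_derivI[OF g(1)]) auto
  have "(p has_field_derivative - deriv g 0 / 3) (at 0)"
    unfolding p_def using g0 by (auto intro!: derivative_eq_intros)
  then have p': "deriv p 0 = - deriv g 0 / 3" by (rule DERIV_imp_deriv)
  have p3: "z / p z ^ 3 = (f z - f 0) / q 0" if "z \<in> ball 0 1" for z
  proof -
    have "p z ^ 3 = exp (g 0 - g z)"
      unfolding p_def by (subst exp_of_nat_mult[symmetric]) (simp add: diff_divide_distrib)
    also have "\<dots> = q 0 / q z"
      using g(2)[of 0] g(2)[OF that] by (simp add: exp_diff)
    finally show ?thesis using q(2)[of z] nz[OF that] nz[of 0] by simp
  qed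
  have "norm (deriv p 0) \<le> 1"
  proof (rule cube_root_area_bound[OF p_hol])
    show "inj_on (\<lambda>z. z / p z ^ 3) (ball 0 1)"
    proof (rule inj_onI)
      fix z w :: complex assume zw: "z \<in> ball 0 1" "w \<in> ball 0 1" "z / p z ^ 3 = w / p w ^ 3"
      then have "f z = f w" using nz[of 0] by (simp add: p3)
      then show "z = w" using inj zw by (auto simp: inj_on_def)
    qed
  qed (auto simp: p_def)
  then have g'_le: "norm (deriv g 0) \<le> 3" by (simp add: p' norm_divide)
  have q': "(q has_field_derivative deriv q z) (at z)" if "z \<in> ball 0 1" for z
    using that by (intro holomorphic_derivI[OF q(1)]) auto
  have "((\<lambda>z. exp (g z)) has_field_derivative q 0 * deriv g 0) (at 0)"
    using g0 g(2)[of 0] by (auto intro!: derivative_eq_intros)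
  moreover have "((\<lambda>z. exp (g z)) has_field_derivative deriv q 0) (at 0)"
    by (rule has_field_derivative_transform_within_open[OF q' open_ball, of _ 0 1]) (auto simp: g(2))
  ultimately have q'0: "deriv q 0 = q 0 * deriv g 0" by (rule DERIV_unique[symmetric])
  have f': "deriv f z = q z + z * deriv q z" if "z \<in> ball 0 1" for z
  proof -
    have "((\<lambda>z. f 0 + z * q z) has_field_derivative q z + z * deriv q z) (at z)"
      using q'[OF that] by (auto intro!: derivative_eq_intros)
    then have "(f has_field_derivative q z + z * deriv q z) (at z)"
      by (rule has_field_derivative_transform_within_open[OF _ open_UNIV]) (auto simp flip: q(2))
    then show ?thesis by (rule DERIV_imp_deriv)
  qed
  have q'': "(deriv q has_field_derivative deriv (deriv q) 0) (at 0)"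
    by (rule holomorphic_derivI[OF holomorphic_deriv[OF q(1)]]) auto
  have "((\<lambda>z. q z + z * deriv q z) has_field_derivative 2 * deriv q 0) (at 0)"
    using q'[of 0] q'' by (auto intro!: derivative_eq_intros)
  then have "(deriv f has_field_derivative 2 * deriv q 0) (at 0)"
    by (rule has_field_derivative_transform_within_open[OF _ open_ball, of _ _ _ 0 1]) (auto simp: f')
  then have "deriv (deriv f) 0 = 2 * (deriv f 0 * deriv g 0)"
    by (simp add: DERIV_imp_deriv q'0 q(3))
  then have "norm (deriv (deriv f) 0) = 2 * norm (deriv f 0) * norm (deriv g 0)"
    by (simp add: norm_mult)
  also have "\<dots> \<le> 2 * norm (deriv f 0) * 3"
    by (intro mult_left_mono g'_le) auto
  finally show ?thesis by simp
qed

subsection \<open>Distortion and growth\<close>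

text \<open>The disc automorphism \<open>m\<close> carries 0 to \<open>c\<close>, so the bound at
  the origin for \<open>f \<circ> m\<close> becomes one at \<open>c\<close>, after cancelling
  \<open>deriv m 0 = 1 - (norm c)\<^sup>2\<close>.\<close>

lemma univalent_koebe_transform_bound:
  fixes f :: "complex \<Rightarrow> complex"
  assumes hol: "f holomorphic_on ball 0 1" and inj: "inj_on f (ball 0 1)" and c: "norm c < 1"
  shows "norm ((1 - (norm c)\<^sup>2) * deriv (deriv f) c - 2 * cnj c * deriv f c) \<le> 6 * norm (deriv f c)"
proof -
  define m :: "complex \<Rightarrow> complex" where "m = Moebius_function 0 (- c)"
  define F where "F = (\<lambda>z. f (m z))"
  have m_eq: "m z = (z + c) / (1 + cnj c * z)" for z by (simp add: m_def Moebius_function_def)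
  have m_ball: "m z \<in> ball 0 1" if "z \<in> ball 0 1" for z
    using that c Moebius_function_norm_lt_1[of "- c" z 0] by (simp add: m_def)
  have m_hol: "m holomorphic_on ball 0 1"
    unfolding m_def using c by (intro Moebius_function_holomorphic) auto
  have m_inj: "inj_on m (ball 0 1)"
    by (rule inj_on_inverseI[of _ "Moebius_function 0 c"])
       (use c in \<open>auto simp: m_def intro!: Moebius_function_compose\<close>)
  have "F holomorphic_on ball 0 1"
    unfolding F_def using m_ball by (intro holomorphic_on_compose_gen[OF m_hol hol, unfolded o_def]) auto
  moreover have "inj_on F (ball 0 1)"
    unfolding F_def by (rule inj_onI, rule inj_onD[OF m_inj], rule inj_onD[OF inj]) (use m_ball in auto)
  ultimately have F: "norm (deriv (deriv F) 0) \<le> 6 * norm (deriv F 0)"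
    by (rule univalent_second_deriv_le)
  have nz: "1 + cnj c * z \<noteq> 0" if "z \<in> ball 0 1" for z
  proof
    assume "1 + cnj c * z = 0"
    then have "cnj c * z = -1" by (simp add: add_eq_0_iff)
    then have "norm c * norm z = 1" by (metis norm_minus_cancel norm_mult norm_one complex_mod_cnj)
    moreover have "norm c * norm z < 1 * 1" using c that by (intro mult_strict_mono') auto
    ultimately show False by simp
  qed
  let ?k = "1 - cnj c * c"
  have m': "(m has_field_derivative ?k / (1 + cnj c * z)\<^sup>2) (at z)" if "z \<in> ball 0 1" for z
    unfolding m_eq[abs_def] using nz[OF that]
    by (auto intro!: derivative_eq_intros simp: power2_eq_square field_simps)
  have F': "deriv F z = deriv f (m z) * (?k / (1 + cnj c * z)\<^sup>2)" if "z \<in> ball 0 1" for z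
    unfolding F_def using m_ball[OF that]
    by (intro DERIV_imp_deriv DERIV_chain2[OF holomorphic_derivI[OF hol open_ball] m'[OF that]]) auto
  have "((\<lambda>z. deriv f (m z)) has_field_derivative deriv (deriv f) (m 0) * (?k / (1 + cnj c * 0)\<^sup>2)) (at 0)"
    using m_ball[of 0]
    by (intro DERIV_chain2[OF holomorphic_derivI[OF holomorphic_deriv[OF hol open_ball] open_ball] m']) auto
  moreover have m0: "m 0 = c" by (simp add: m_eq)
  ultimately have "((\<lambda>z. deriv f (m z)) has_field_derivative deriv (deriv f) c * ?k) (at 0)" by simp
  then have "((\<lambda>z. deriv f (m z) * (?k / (1 + cnj c * z)\<^sup>2)) has_field_derivative
      deriv (deriv f) c * ?k * ?k - deriv f c * ?k * 2 * cnj c) (at 0)"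
    by (auto intro!: derivative_eq_intros simp: m0 algebra_simps)
  then have "(deriv F has_field_derivative deriv (deriv f) c * ?k * ?k - deriv f c * ?k * 2 * cnj c) (at 0)"
    by (rule has_field_derivative_transform_within_open[OF _ open_ball, of _ _ _ 0 1]) (auto simp: F')
  then have F'': "deriv (deriv F) 0 = ?k * (?k * deriv (deriv f) c - 2 * cnj c * deriv f c)"
    by (simp add: DERIV_imp_deriv algebra_simps)
  have F'0: "deriv F 0 = deriv f c * ?k" by (simp add: F' m0)
  have k: "?k = of_real (1 - (norm c)\<^sup>2)"
    by (simp add: complex_norm_square mult.commute del: of_real_power)
  have "(norm c)\<^sup>2 < 1" using c by (simp add: power_less_one_iff)
  then have k0: "0 < norm ?k" unfolding k norm_of_real by simp
  have "norm ?k * norm (?k * deriv (deriv f) c - 2 * cnj c * deriv f c) \<le> norm ?k * (6 * norm (deriv f c))"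
    using F unfolding F'' F'0 norm_mult by (simp only: mult_ac)
  then have "norm (?k * deriv (deriv f) c - 2 * cnj c * deriv f c) \<le> 6 * norm (deriv f c)"
    using k0 by (rule mult_left_le_imp_le)
  then show ?thesis unfolding k .
qed

text \<open>Along a ray, the transform bound limits the derivative of
  \<open>ln (norm (deriv f))\<close> to
  \<open>(6 + 2 * t) / (1 - t\<^sup>2) = 2 / (1 + t) + 4 / (1 - t)\<close>; integration from 0 gives
  the exponents. The sharp constant 4 in place of 6 would give
  \<open>(1 + t) / (1 - t) ^ 3\<close>.\<close>

lemma univalent_distortion:
  fixes f :: "complex \<Rightarrow> complex"
  assumes hol: "f holomorphic_on ball 0 1" and inj: "inj_on f (ball 0 1)" and z: "norm z < 1"
  shows "norm (deriv f z) \<le> norm (deriv f 0) * ((1 + norm z)\<^sup>2 / (1 - norm z) ^ 4)"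
proof (cases "z = 0")
  case False
  define \<omega> where "\<omega> = sgn z"
  have \<omega>: "norm \<omega> = 1" "z = norm z * \<omega>"
    using False by (simp add: \<omega>_def norm_sgn, simp add: \<omega>_def sgn_div_norm scaleR_conv_of_real)
  have nz: "deriv f w \<noteq> 0" if "w \<in> ball 0 1" for w
    using holomorphic_injective_imp_regular[OF hol open_ball inj that] .
  have f'_hol: "deriv f holomorphic_on ball 0 1" by (intro holomorphic_deriv hol open_ball)
  obtain g where g: "g holomorphic_on ball 0 1" "\<And>w. w \<in> ball 0 1 \<Longrightarrow> exp (g w) = deriv f w"
    using holomorphic_logarithm_exists[OF convex_ball open_ball f'_hol nz, of 0] by auto
  have g': "(g has_field_derivative deriv (deriv f) w / deriv f w) (at w)" if w: "w \<in> ball 0 1" for w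
  proof -
    have gd: "(g has_field_derivative deriv g w) (at w)"
      by (rule holomorphic_derivI[OF g(1) open_ball w])
    then have "((\<lambda>z. exp (g z)) has_field_derivative deriv f w * deriv g w) (at w)"
      using g(2)[OF w] by (auto intro!: derivative_eq_intros)
    moreover have "((\<lambda>z. exp (g z)) has_field_derivative deriv (deriv f) w) (at w)"
      by (rule has_field_derivative_transform_within_open[OF holomorphic_derivI[OF f'_hol open_ball w] open_ball w])
        (simp add: g(2))
    ultimately have "deriv (deriv f) w = deriv f w * deriv g w" by (rule DERIV_unique[symmetric])
    then show ?thesis using gd nz[OF w] by simp
  qed
  have f''_le: "norm (deriv (deriv f) w / deriv f w) \<le> (6 + 2 * norm w) / (1 - (norm w)\<^sup>2)"
    if w: "w \<in> ball 0 1" for w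
  proof -
    have pos: "0 < 1 - (norm w)\<^sup>2" using w by (simp add: power_less_one_iff)
    have "(1 - (norm w)\<^sup>2) * norm (deriv (deriv f) w) = norm ((1 - (norm w)\<^sup>2) * deriv (deriv f) w)"
      using pos by (simp add: norm_mult del: of_real_diff of_real_power)
    also have "\<dots> \<le> norm ((1 - (norm w)\<^sup>2) * deriv (deriv f) w - 2 * cnj w * deriv f w) + norm (2 * cnj w * deriv f w)"
      by (metis diff_add_cancel norm_triangle_ineq)
    also have "\<dots> \<le> 6 * norm (deriv f w) + 2 * norm w * norm (deriv f w)"
      using univalent_koebe_transform_bound[OF hol inj, of w] w by (simp add: norm_mult)
    finally show ?thesis
      using pos nz[OF w] by (simp add: norm_divide field_simps)
  qed
  \<comment> \<open>\<open>L\<close> is the primitive of the bound with \<open>L 0 = 0\<close>;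
    monotonicity of \<open>D\<close> takes the place of an integration.\<close>
  define L where "L = (\<lambda>t::real. 2 * ln (1 + t) - 4 * ln (1 - t))"
  define D where "D = (\<lambda>t::real. Re (g (of_real t * \<omega>)) - L t)"
  have "D (norm z) \<le> D 0"
  proof (rule DERIV_nonpos_imp_nonincreasing[where f = D and a = 0 and b = "norm z"])
    fix t :: real assume t: "0 \<le> t" "t \<le> norm z"
    then have t1: "t < 1" using z by simp
    define w where "w = of_real t * \<omega>"
    have w: "w \<in> ball 0 1" "norm w = t" using t t1 \<omega> by (auto simp: w_def norm_mult)
    let ?d = "\<omega> * (deriv (deriv f) w / deriv f w)"
    have "((\<lambda>t. of_real t * \<omega>) has_vector_derivative \<omega>) (at t)"
      using has_vector_derivative_mult_left[OF has_vector_derivative_of_real[OF DERIV_ident], of \<omega>] by simp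
    then have "((\<lambda>t. g (of_real t * \<omega>)) has_vector_derivative ?d) (at t)"
      using field_vector_diff_chain_at[of "\<lambda>t. of_real t * \<omega>" \<omega> t g] g'[OF w(1)] unfolding w_def o_def by blast
    then have "((\<lambda>t. Re (g (of_real t * \<omega>))) has_real_derivative Re ?d) (at t)"
      unfolding has_real_derivative_iff_has_vector_derivative
      by (rule bounded_linear.has_vector_derivative[OF bounded_linear_Re])
    moreover have "(L has_real_derivative 2 / (1 + t) + 4 / (1 - t)) (at t)"
      unfolding L_def using t t1 by (auto intro!: derivative_eq_intros)
    ultimately have "(D has_real_derivative Re ?d - (2 / (1 + t) + 4 / (1 - t))) (at t)"
      unfolding D_def by (rule DERIV_diff)
    moreover have "Re ?d \<le> 2 / (1 + t) + 4 / (1 - t)"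
    proof -
      have "Re ?d \<le> norm ?d" by (rule complex_Re_le_cmod)
      also have "\<dots> \<le> (6 + 2 * t) / (1 - t\<^sup>2)"
        using f''_le[OF w(1)] by (simp only: norm_mult \<omega>(1) w(2) mult_1_left)
      also have "1 - t\<^sup>2 = (1 + t) * (1 - t)" by (simp add: power2_eq_square algebra_simps)
      also have "(6 + 2 * t) / ((1 + t) * (1 - t)) = 2 / (1 + t) + 4 / (1 - t)"
        using t t1 by (simp add: field_simps)
      finally show ?thesis .
    qed
    ultimately show "\<exists>y. (D has_real_derivative y) (at t) \<and> y \<le> 0" by (intro exI conjI) auto
  qed auto
  then have "Re (g z) \<le> Re (g 0) + L (norm z)"
    using \<omega>(2) by (simp add: D_def L_def)
  then have "exp (Re (g z)) \<le> exp (Re (g 0)) * exp (L (norm z))"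
    by (simp flip: exp_add)
  moreover have "0 < 1 + norm z" by (simp add: add_pos_nonneg)
  then have "exp (L (norm z)) = (1 + norm z)\<^sup>2 / (1 - norm z) ^ 4"
    using z exp_of_nat_mult[of 2 "ln (1 + norm z)"] exp_of_nat_mult[of 4 "ln (1 - norm z)"]
    by (simp add: L_def exp_diff)
  moreover have "exp (Re (g z)) = norm (deriv f z)" "exp (Re (g 0)) = norm (deriv f 0)"
    using z g(2)[of z] g(2)[of 0] by (metis mem_ball_0 norm_exp_eq_Re, metis centre_in_ball norm_exp_eq_Re zero_less_one)
  ultimately show ?thesis by simp
qed simp

text \<open>The distortion bound is integrated along the ray to \<open>z\<close>:
  \<open>(t + t ^ 3 / 3) / (1 - t) ^ 3\<close> is the primitive of
  \<open>(1 + t)\<^sup>2 / (1 - t) ^ 4\<close> that vanishes at 0.\<close>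

lemma univalent_growth:
  fixes f :: "complex \<Rightarrow> complex"
  assumes hol: "f holomorphic_on ball 0 1" and inj: "inj_on f (ball 0 1)" and z: "norm z < 1"
  shows "norm (f z - f 0) \<le> norm (deriv f 0) * ((norm z + norm z ^ 3 / 3) / (1 - norm z) ^ 3)"
proof (cases "z = 0")
  case False
  define \<omega> where "\<omega> = sgn z"
  have \<omega>: "norm \<omega> = 1" "z = norm z * \<omega>"
    using False by (simp add: \<omega>_def norm_sgn, simp add: \<omega>_def sgn_div_norm scaleR_conv_of_real)
  \<comment> \<open>Rotating \<open>f z - f 0\<close> onto the positive axis replaces a norm by a
    real part, which can be differentiated along the ray. As \<open>sgn 0 = 0\<close>, the bound
    \<open>norm \<eta> \<le> 1\<close> holds in every case.\<close>
  define \<eta> where "\<eta> = cnj (sgn (f z - f 0))"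
  have \<eta>: "norm \<eta> \<le> 1" by (simp add: \<eta>_def norm_sgn)
  have \<eta>f: "Re (\<eta> * (f z - f 0)) = norm (f z - f 0)"
  proof -
    have "cnj (sgn v) * v = of_real (norm v)" for v :: complex
    proof -
      have "cnj (sgn v) * v = v * cnj v / of_real (norm v)" by (simp add: sgn_eq)
      also have "\<dots> = of_real (norm v)"
        by (subst complex_norm_square[symmetric]) (simp add: power2_eq_square)
      finally show ?thesis .
    qed
    then have "\<eta> * (f z - f 0) = of_real (norm (f z - f 0))" unfolding \<eta>_def .
    then show ?thesis by simp
  qed
  let ?A = "norm (deriv f 0)"
  define L where "L = (\<lambda>t::real. ?A * ((t + t ^ 3 / 3) / (1 - t) ^ 3))"
  define D where "D = (\<lambda>t::real. Re (\<eta> * (f (of_real t * \<omega>) - f 0)) - L t)"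
  have "D (norm z) \<le> D 0"
  proof (rule DERIV_nonpos_imp_nonincreasing[where f = D and a = 0 and b = "norm z"])
    fix t :: real assume t: "0 \<le> t" "t \<le> norm z"
    then have t1: "t < 1" using z by simp
    define w where "w = of_real t * \<omega>"
    have w: "w \<in> ball 0 1" "norm w = t" using t t1 \<omega> by (auto simp: w_def norm_mult)
    have f': "((\<lambda>w. \<eta> * (f w - f 0)) has_field_derivative \<eta> * deriv f w) (at w)"
      using holomorphic_derivI[OF hol open_ball w(1)] by (auto intro!: derivative_eq_intros)
    let ?d = "\<omega> * (\<eta> * deriv f w)"
    have "((\<lambda>t. of_real t * \<omega>) has_vector_derivative \<omega>) (at t)"
      using has_vector_derivative_mult_left[OF has_vector_derivative_of_real[OF DERIV_ident], of \<omega>] by simp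
    then have "((\<lambda>t. \<eta> * (f (of_real t * \<omega>) - f 0)) has_vector_derivative ?d) (at t)"
      using field_vector_diff_chain_at[of "\<lambda>t. of_real t * \<omega>" \<omega> t "\<lambda>w. \<eta> * (f w - f 0)"] f'
      unfolding w_def o_def by blast
    then have "((\<lambda>t. Re (\<eta> * (f (of_real t * \<omega>) - f 0))) has_real_derivative Re ?d) (at t)"
      unfolding has_real_derivative_iff_has_vector_derivative
      by (rule bounded_linear.has_vector_derivative[OF bounded_linear_Re])
    moreover have "(L has_real_derivative ?A * ((1 + t)\<^sup>2 / (1 - t) ^ 4)) (at t)"
    proof -
      have "((\<lambda>t. (t + t ^ 3 / 3) / (1 - t) ^ 3) has_real_derivative
          ((1 + t\<^sup>2) * (1 - t) ^ 3 + (t + t ^ 3 / 3) * (3 * (1 - t)\<^sup>2)) / ((1 - t) ^ 3)\<^sup>2) (at t)"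
        using t1 by (auto intro!: derivative_eq_intros simp: power2_eq_square)
      also have "(1 + t\<^sup>2) * (1 - t) ^ 3 + (t + t ^ 3 / 3) * (3 * (1 - t)\<^sup>2) = (1 - t)\<^sup>2 * (1 + t)\<^sup>2"
        by (simp add: power2_eq_square power3_eq_cube algebra_simps)
      also have "((1 - t) ^ 3)\<^sup>2 = (1 - t)\<^sup>2 * (1 - t) ^ 4"
        by (simp flip: power_mult power_add)
      also have "(1 - t)\<^sup>2 * (1 + t)\<^sup>2 / ((1 - t)\<^sup>2 * (1 - t) ^ 4) = (1 + t)\<^sup>2 / (1 - t) ^ 4"
        by (subst mult_divide_mult_cancel_left) (use t1 in auto)
      finally have "((\<lambda>t. (t + t ^ 3 / 3) / (1 - t) ^ 3) has_real_derivative (1 + t)\<^sup>2 / (1 - t) ^ 4) (at t)" .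
      then show ?thesis unfolding L_def by (rule DERIV_cmult)
    qed
    ultimately have "(D has_real_derivative Re ?d - ?A * ((1 + t)\<^sup>2 / (1 - t) ^ 4)) (at t)"
      unfolding D_def by (rule DERIV_diff)
    moreover have "Re ?d \<le> ?A * ((1 + t)\<^sup>2 / (1 - t) ^ 4)"
    proof -
      have "Re ?d \<le> norm ?d" by (rule complex_Re_le_cmod)
      also have "\<dots> = norm \<eta> * norm (deriv f w)" using \<omega>(1) by (simp add: norm_mult)
      also have "\<dots> \<le> norm (deriv f w)" using \<eta> by (intro mult_left_le_one_le) auto
      also have "\<dots> \<le> ?A * ((1 + t)\<^sup>2 / (1 - t) ^ 4)"
        using univalent_distortion[OF hol inj, of w] w by simp
      finally show ?thesis .
    qed
    ultimately show "\<exists>y. (D has_real_derivative y) (at t) \<and> y \<le> 0" by (intro exI conjI) auto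
  qed auto
  then show ?thesis using \<omega>(2) \<eta>f by (simp add: D_def L_def)
qed simp

subsection \<open>Capacity of subsets of discs\<close>

text \<open>The difference of the squares factors. This bounds the singular kernel
  \<open>- ln (norm (u - v))\<close> below by \<open>- ln (norm (1 - u * cnj v))\<close>, which is
  smooth inside the disc.\<close>

lemma norm_diff_le_norm_one_minus:
  fixes u v :: complex
  assumes "norm u \<le> 1" "norm v \<le> 1"
  shows "norm (u - v) \<le> norm (1 - u * cnj v)"
proof -
  have "(norm (1 - u * cnj v))\<^sup>2 - (norm (u - v))\<^sup>2 = (1 - (norm u)\<^sup>2) * (1 - (norm v)\<^sup>2)"
    unfolding cmod_power2 by (simp add: power2_eq_square algebra_simps)
  moreover have "\<dots> \<ge> 0" using assms by (intro mult_nonneg_nonneg) (auto simp: power_le_one)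
  ultimately have "(norm (u - v))\<^sup>2 \<le> (norm (1 - u * cnj v))\<^sup>2" by linarith
  then show ?thesis by (rule power2_le_imp_le) simp
qed

text \<open>
  Expanding \<open>- ln \<bar>1 - \<zeta>\<bar> = (\<Sum>n\<ge>1. Re (\<zeta> ^ n) / n)\<close> turns the integral into
  \<open>\<Sum>n\<ge>1. \<bar>\<integral> U ^ n \<partial>M\<bar>\<^sup>2 / n\<close>.
\<close>
lemma integral_log_kernel_disc_nonneg:
  fixes U :: "'a \<Rightarrow> complex"
  assumes "prob_space M" and U[measurable]: "U \<in> borel_measurable M"
    and q: "\<And>x. norm (U x) \<le> q" "q < 1"
  shows "integrable (M \<Otimes>\<^sub>M M) (\<lambda>(x, y). - ln (norm (1 - U x * cnj (U y))))" (is ?int)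
    and "0 \<le> (\<integral>(x, y). - ln (norm (1 - U x * cnj (U y))) \<partial>(M \<Otimes>\<^sub>M M))" (is ?nonneg)
proof -
  interpret M: prob_space M by fact
  interpret P: pair_prob_space M M ..
  have q0: "0 \<le> q" using q(1) order_trans[OF norm_ge_zero] by blast
  have cnj_U[measurable]: "(\<lambda>x. cnj (U x)) \<in> borel_measurable M"
    by (intro measurable_compose[OF U] borel_measurable_continuous_onI continuous_intros)
  \<comment> \<open>The term \<open>n = 0\<close> vanishes, since division by \<open>real 0\<close>
    gives 0, so the series can start at 0.\<close>
  define s where "s = (\<lambda>n x. Re ((U (fst x) * cnj (U (snd x))) ^ n) / real n)"
  define S where "S = (\<lambda>x. - ln (norm (1 - U (fst x) * cnj (U (snd x)))))"
  have \<zeta>: "norm (U x * cnj (U y)) \<le> q" for x y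
  proof -
    have "norm (U x) * norm (U y) \<le> q * 1" using q q0 by (intro mult_mono) (auto intro: order_trans less_imp_le)
    then show ?thesis by (simp add: norm_mult)
  qed
  have s_le: "norm (s n x) \<le> q ^ n" for n x
  proof (cases "n = 0")
    case False
    have "norm (s n x) \<le> norm ((U (fst x) * cnj (U (snd x))) ^ n) / real n"
      unfolding s_def real_norm_def abs_divide by (intro divide_mono) (use False abs_Re_le_cmod in auto)
    also have "\<dots> \<le> norm ((U (fst x) * cnj (U (snd x))) ^ n) / 1" using False by (intro divide_left_mono) auto
    also have "\<dots> \<le> q ^ n" using \<zeta> by (simp add: norm_power power_mono)
    finally show ?thesis .
  qed (simp add: s_def)
  have sums: "(\<lambda>n. s n x) sums S x" for x
  proof -
    define z where "z = - (U (fst x) * cnj (U (snd x)))"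
    have z: "norm z < 1" using \<zeta> q(2) unfolding z_def norm_minus_cancel by (rule le_less_trans)
    then have "1 + z \<noteq> 0" by (metis add_eq_0_iff norm_minus_cancel norm_one order_less_irrefl)
    then have "Re (Ln (1 + z)) = ln (norm (1 + z))" by simp
    moreover have "(\<lambda>n. Re (- ((- z) ^ n) / of_nat n)) sums Re (Ln (1 + z))"
      by (intro sums_Re Ln_series' z)
    ultimately have "(\<lambda>n. - Re (- ((- z) ^ n) / of_nat n)) sums - ln (norm (1 + z))"
      by (metis sums_minus)
    moreover have "- Re (- ((- z) ^ n) / of_nat n) = s n x" for n
      by (simp add: s_def z_def)
    ultimately show ?thesis by (simp add: S_def z_def)
  qed
  have s_meas[measurable]: "s n \<in> borel_measurable (M \<Otimes>\<^sub>M M)" for n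
    unfolding s_def by measurable
  have S_meas[measurable]: "S \<in> borel_measurable (M \<Otimes>\<^sub>M M)"
    unfolding S_def by measurable
  have s_int: "integrable (M \<Otimes>\<^sub>M M) (s n)" for n
    by (rule P.integrable_const_bound[where B="q ^ n"]) (use s_le in auto)
  have s_nonneg: "0 \<le> (\<integral>x. s n x \<partial>(M \<Otimes>\<^sub>M M))" for n
  proof -
    have "integrable (M \<Otimes>\<^sub>M M) (\<lambda>(x, y). U x ^ n * cnj (U y ^ n))"
    proof (rule P.integrable_const_bound[where B=1])
      have "norm (U x ^ n * cnj (U y ^ n)) \<le> 1" for x y
        using \<zeta>[of x y] q(2) by (simp flip: power_mult_distrib add: norm_power power_le_one)
      then show "AE x in M \<Otimes>\<^sub>M M. norm (case x of (x, y) \<Rightarrow> U x ^ n * cnj (U y ^ n)) \<le> 1" by auto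
    qed (unfold complex_cnj_power, measurable)
    note this[THEN P.integral_fst]
    moreover have "integrable M (\<lambda>x. U x ^ n)"
    proof (rule M.integrable_const_bound[where B=1])
      have "norm (U x) \<le> 1" for x using q less_imp_le order_trans by blast
      then show "AE x in M. norm (U x ^ n) \<le> 1" by (simp add: norm_power power_le_one)
    qed measurable
    ultimately have *: "(\<integral>(x, y). U x ^ n * cnj (U y ^ n) \<partial>(M \<Otimes>\<^sub>M M)) = (\<integral>x. U x ^ n \<partial>M) * cnj (\<integral>x. U x ^ n \<partial>M)"
      by (simp del: complex_cnj_power)
    have "(\<integral>x. s n x \<partial>(M \<Otimes>\<^sub>M M)) = (\<integral>x. Re (case x of (x, y) \<Rightarrow> U x ^ n * cnj (U y ^ n)) / real n \<partial>(M \<Otimes>\<^sub>M M))"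
      by (intro Bochner_Integration.integral_cong) (auto simp: s_def power_mult_distrib)
    also have "\<dots> = Re (\<integral>(x, y). U x ^ n * cnj (U y ^ n) \<partial>(M \<Otimes>\<^sub>M M)) / real n"
      using \<open>integrable (M \<Otimes>\<^sub>M M) (\<lambda>(x, y). U x ^ n * cnj (U y ^ n))\<close> by simp
    also have "\<dots> = (norm (\<integral>x. U x ^ n \<partial>M))\<^sup>2 / real n"
      unfolding * by (simp flip: complex_norm_square)
    finally show ?thesis by simp
  qed
  have lim: "(\<lambda>N. \<Sum>n<N. s n x) \<longlonglongrightarrow> S x" for x using sums by (simp add: sums_def)
  have bound: "norm (\<Sum>n<N. s n x) \<le> 1 / (1 - q)" for N x
  proof -
    have "norm (\<Sum>n<N. s n x) \<le> (\<Sum>n<N. q ^ n)" using s_le by (intro sum_norm_le) auto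
    also have "\<dots> \<le> (\<Sum>n. q ^ n)" using q q0 by (intro sum_le_suminf summable_geometric) auto
    also have "\<dots> = 1 / (1 - q)" using q q0 by (intro suminf_geometric) auto
    finally show ?thesis .
  qed
  have "integrable (M \<Otimes>\<^sub>M M) S"
    by (rule integrable_dominated_convergence[where w="\<lambda>_. 1 / (1 - q)" and s="\<lambda>N x. \<Sum>n<N. s n x"])
      (use lim bound in auto)
  moreover have "(\<lambda>N. \<integral>x. (\<Sum>n<N. s n x) \<partial>(M \<Otimes>\<^sub>M M)) \<longlonglongrightarrow> (\<integral>x. S x \<partial>(M \<Otimes>\<^sub>M M))"
    by (rule integral_dominated_convergence[where w="\<lambda>_. 1 / (1 - q)"])
      (use lim bound in auto)
  moreover have "0 \<le> (\<integral>x. (\<Sum>n<N. s n x) \<partial>(M \<Otimes>\<^sub>M M))" for N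
    using s_int s_nonneg by (simp add: sum_nonneg)
  ultimately have "integrable (M \<Otimes>\<^sub>M M) S" "0 \<le> (\<integral>x. S x \<partial>(M \<Otimes>\<^sub>M M))"
    by (auto intro: LIMSEQ_le_const)
  then show ?int ?nonneg by (simp_all add: S_def case_prod_beta')
qed

text \<open>With \<open>u = (z - c) / \<sigma>\<close> and \<open>v = (w - c) / \<sigma>\<close>,
  the kernel is at least \<open>- ln \<sigma> - ln (norm (1 - u * cnj v))\<close>, whose second part
  has nonnegative integral. Taking \<open>\<sigma>\<close> above \<open>\<rho>\<close> keeps
  \<open>u\<close> and \<open>v\<close> in a disc of radius below 1, where the series is dominated
  by a geometric one.\<close>

lemma log_energy_ge:
  fixes c :: complex
  assumes "prob_space \<mu>" and sets[measurable_cong]: "sets \<mu> = sets borel"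
    and AE: "AE z in \<mu>. z \<in> cball c \<rho>" and \<rho>: "0 \<le> \<rho>" "\<rho> < \<sigma>"
  shows "ereal (- ln \<sigma>) \<le> log_energy \<mu>"
proof -
  interpret M: prob_space \<mu> by fact
  interpret P: pair_prob_space \<mu> \<mu> ..
  let ?N = "\<mu> \<Otimes>\<^sub>M \<mu>"
  \<comment> \<open>The value 0 off the disc makes the bound on \<open>norm (U z)\<close> hold
    everywhere, not just almost everywhere.\<close>
  define U where "U = (\<lambda>z. if z \<in> cball c \<rho> then (z - c) / of_real \<sigma> else 0)"
  have [measurable]: "cball c \<rho> \<in> sets borel" by simp
  have U_meas: "U \<in> borel_measurable \<mu>" unfolding U_def by measurable
  have U_le: "norm (U z) \<le> \<rho> / \<sigma>" for z
    using \<rho> by (auto simp: U_def norm_divide dist_norm norm_minus_commute divide_right_mono)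
  have q: "\<rho> / \<sigma> < 1" using \<rho> by simp
  define C where "C = (\<lambda>(z, w). - ln \<sigma> + - ln (norm (1 - U z * cnj (U w))))"
  note pos = integral_log_kernel_disc_nonneg[OF M.prob_space_axioms U_meas U_le q]
  have C_int: "integrable ?N C"
    using Bochner_Integration.integrable_add[OF P.integrable_const pos(1)] by (simp add: C_def case_prod_beta')
  have "- ln \<sigma> \<le> (\<integral>x. C x \<partial>?N)"
    using pos Bochner_Integration.integral_add[OF P.integrable_const[of "- ln \<sigma>"] pos(1)] P.prob_space
    by (simp add: C_def case_prod_beta')
  have C_le: "ereal (C (z, w)) \<le> log_kernel (z, w)" if zw: "z \<in> cball c \<rho>" "w \<in> cball c \<rho>" for z w
  proof (cases "z = w")
    case False
    have "z - w = of_real \<sigma> * (U z - U w)"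
      using zw \<rho> by (simp add: U_def field_simps)
    then have "norm (z - w) = \<sigma> * norm (U z - U w)" using \<rho> by (simp add: norm_mult)
    also have "\<dots> \<le> \<sigma> * norm (1 - U z * cnj (U w))"
      using \<rho> q by (intro mult_left_mono norm_diff_le_norm_one_minus order_trans[OF U_le]) auto
    finally have le: "norm (z - w) \<le> \<sigma> * norm (1 - U z * cnj (U w))" .
    moreover have pos: "0 < norm (z - w)" using False by simp
    ultimately have "0 < \<sigma> * norm (1 - U z * cnj (U w))" by linarith
    with \<rho> have "0 < norm (1 - U z * cnj (U w))" by (simp add: zero_less_mult_iff)
    then have "ln (norm (z - w)) \<le> ln \<sigma> + ln (norm (1 - U z * cnj (U w)))"
      using le pos \<rho> by (subst ln_mult_pos[symmetric]) (auto intro!: ln_mono)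
    then show ?thesis using False pos by (simp add: log_kernel_def C_def ln_div)
  qed (simp add: log_kernel_def)
  have AE_C: "AE x in ?N. ereal (C x) \<le> log_kernel x"
  proof -
    have "AE x in ?N. fst x \<in> cball c \<rho> \<and> snd x \<in> cball c \<rho>"
      using AE by (intro P.AE_pair_measure) (auto simp: space_pair_measure)
    then show ?thesis by eventually_elim (use C_le in auto)
  qed
  \<comment> \<open>Since \<open>log_energy\<close> is a difference of extended integrals,
    \<open>C\<close> is compared with the kernel on positive and negative parts separately; both
    parts of \<open>C\<close> have finite integral.\<close>
  define A where "A = (\<integral>\<^sup>+x. ennreal (C x) \<partial>?N)"
  define B where "B = (\<integral>\<^sup>+x. ennreal (- C x) \<partial>?N)"
  have "A \<noteq> \<infinity>" "B \<noteq> \<infinity>" using C_int by (auto simp: real_integrable_def A_def B_def)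
  then have AB: "enn2ereal A = ereal (enn2real A)" "enn2ereal B = ereal (enn2real B)"
    by (metis enn2ereal_ennreal ennreal_enn2real enn2real_nonneg infinity_ennreal_def top.not_eq_extremum)+
  have "ereal (- ln \<sigma>) \<le> ereal (enn2real A - enn2real B)"
    using \<open>- ln \<sigma> \<le> _\<close> real_lebesgue_integral_def[OF C_int] by (simp add: A_def B_def)
  also have "\<dots> = enn2ereal A - enn2ereal B" by (simp add: AB)
  also have "\<dots> \<le> log_energy \<mu>"
    unfolding log_energy_def
  proof (rule ereal_minus_mono)
    have "A \<le> (\<integral>\<^sup>+ x. e2ennreal (log_kernel x) \<partial>?N)"
      unfolding A_def by (rule nn_integral_mono_AE, use AE_C in eventually_elim) (metis e2ennreal_mono e2ennreal_ereal)
    then show "enn2ereal A \<le> enn2ereal (\<integral>\<^sup>+ x. e2ennreal (log_kernel x) \<partial>?N)"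
      by (simp add: less_eq_ennreal.rep_eq)
    have "(\<integral>\<^sup>+ x. e2ennreal (- log_kernel x) \<partial>?N) \<le> B"
      unfolding B_def by (rule nn_integral_mono_AE, use AE_C in eventually_elim)
        (metis e2ennreal_mono e2ennreal_ereal ereal_minus_le_minus uminus_ereal.simps(1))
    then show "enn2ereal (\<integral>\<^sup>+ x. e2ennreal (- log_kernel x) \<partial>?N) \<le> enn2ereal B"
      by (simp add: less_eq_ennreal.rep_eq)
  qed
  finally show ?thesis .
qed

lemma log_capacity_le_radius:
  assumes E: "E \<subseteq> cball c \<rho>" and \<rho>: "0 \<le> \<rho>"
  shows "log_capacity E \<le> \<rho>"
proof (rule dense_ge)
  fix \<sigma> assume \<sigma>: "\<rho> < \<sigma>"
  have "ereal (- ln \<sigma>) \<le> min_energy E"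
    unfolding min_energy_def
  proof (rule INF_greatest)
    fix \<mu> assume "\<mu> \<in> prob_measures_on E"
    then have \<mu>: "prob_space \<mu>" "sets \<mu> = sets borel" "emeasure \<mu> E = 1"
      by (auto simp: prob_measures_on_def)
    then interpret prob_space \<mu> by simp
    \<comment> \<open>Non-measurable sets have \<open>emeasure\<close> 0, so the value 1 carries
      measurability of \<open>E\<close> with it.\<close>
    have "AE z in \<mu>. z \<in> E"
      using \<mu>(3) by (intro AE_prob_1) (simp add: measure_def)
    then have "AE z in \<mu>. z \<in> cball c \<rho>" by (rule eventually_mono) (use E in auto)
    then show "ereal (- ln \<sigma>) \<le> log_energy \<mu>" using \<mu> \<rho> \<sigma> by (intro log_energy_ge)
  qed
  moreover have "exp (- m) \<le> \<sigma>" if "- ln \<sigma> \<le> m" for m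
  proof -
    have "exp (- m) \<le> exp (ln \<sigma>)" using that by simp
    then show ?thesis using \<rho> \<sigma> by simp
  qed
  \<comment> \<open>The lower bound excludes the energy \<open>-\<infinity>\<close>; for
    \<open>\<infinity>\<close> the capacity is 0.\<close>
  ultimately show "log_capacity E \<le> \<sigma>"
    using \<rho> \<sigma> by (cases "min_energy E") (auto simp: log_capacity_def)
qed

subsection \<open>The capacity estimate\<close>

text \<open>Clearing denominators gives \<open>P * D = Q * N\<close>, and coprimality with equal
  degrees forces \<open>D = smult k Q\<close> and \<open>N = smult k P\<close>. At
  \<open>p i\<close>, \<open>pderiv D\<close> is the product of the \<open>p i - p l\<close> over
  \<open>l \<noteq> i\<close>, and \<open>N\<close> is \<open>a i\<close> times it. The second
  equation serves to show that \<open>Q / P\<close> has derivative \<open>1 / a i\<close> at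
  \<open>p i\<close>.\<close>

lemma simple_pole_of_partial_fraction:
  fixes a p :: "nat \<Rightarrow> complex" and P Q :: "complex poly"
  assumes cop: "coprime P Q" and deg: "degree Q = d" and Q: "Q \<noteq> 0"
    and eq: "\<And>z. z \<notin> p ` {1..d} \<Longrightarrow> poly Q z \<noteq> 0 \<Longrightarrow> poly P z / poly Q z = (\<Sum>j=1..d. a j / (z - p j))"
    and i: "i \<in> {1..d}"
  shows "poly Q (p i) = 0" "poly (pderiv Q) (p i) * a i = poly P (p i)"
proof -
  let ?I = "{1..d}"
  define N where "N = (\<Sum>j\<in>?I. smult (a j) (\<Prod>l\<in>?I - {j}. [:- p l, 1:]))"
  define D where "D = (\<Prod>l\<in>?I. [:- p l, 1:])"
  have D0: "D \<noteq> 0" unfolding D_def by simp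
  have degD: "degree D = d" unfolding D_def by (subst degree_prod_eq_sum_degree) auto
  have "P * D = Q * N"
  proof (rule ccontr)
    assume "P * D \<noteq> Q * N"
    then have fin: "finite {z. poly (P * D - Q * N) z = 0}" by (intro poly_roots_finite) auto
    have "finite {z. poly Q z = 0}" using Q by (rule poly_roots_finite)
    with fin have "finite ({z. poly (P * D - Q * N) z = 0} \<union> {z. poly Q z = 0} \<union> p ` ?I)"
      by (intro finite_UnI finite_imageI) auto
    from ex_new_if_finite[OF infinite_UNIV_char_0 this]
    obtain z where z: "poly (P * D - Q * N) z \<noteq> 0" "poly Q z \<noteq> 0" "z \<notin> p ` ?I"
      by blast
    have nz: "z - p l \<noteq> 0" if "l \<in> ?I" for l using z(3) that by auto
    have "poly N z = (\<Sum>j\<in>?I. a j * (\<Prod>l\<in>?I - {j}. z - p l))"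
      by (simp add: N_def poly_sum poly_prod)
    also have "\<dots> = (\<Sum>j\<in>?I. a j / (z - p j) * (\<Prod>l\<in>?I. z - p l))"
    proof (rule sum.cong)
      fix j assume "j \<in> ?I"
      then show "a j * (\<Prod>l\<in>?I - {j}. z - p l) = a j / (z - p j) * (\<Prod>l\<in>?I. z - p l)"
        using nz by (subst prod.remove[of ?I j "\<lambda>l. z - p l"]) auto
    qed simp
    also have "\<dots> = poly P z / poly Q z * poly D z"
      unfolding eq[OF z(3,2)] sum_distrib_right D_def poly_prod by simp
    finally have "poly Q z * poly N z = poly P z * poly D z" using z(2) by simp
    with z(1) show False by simp
  qed
  \<comment> \<open>\<open>Q\<close> divides \<open>D\<close> and both have degree \<open>d\<close>, so they agree up to a constant factor.\<close>
  moreover from this have "Q dvd P * D" by simp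
  then have "Q dvd D"
    using coprime_dvd_mult_right_iff[of Q P D] cop by (simp add: coprime_commute)
  then obtain e where e: "D = Q * e" by (elim dvdE)
  then have "e \<noteq> 0" using D0 by auto
  then have "degree e = 0" using degD deg Q by (simp add: e degree_mult_eq)
  then obtain k where k: "e = [:k:]" by (rule degree_eq_zeroE)
  with \<open>e \<noteq> 0\<close> have k0: "k \<noteq> 0" by simp
  have DQ: "D = smult k Q" by (simp add: e k)
  ultimately have "Q * N = Q * smult k P" by (simp add: mult.commute)
  then have NP: "N = smult k P" using Q by (simp only: mult_cancel_left) simp
  define D' where "D' = (\<Prod>l\<in>?I - {i}. [:- p l, 1:])"
  have Di: "D = [:- p i, 1:] * D'" unfolding D_def D'_def using i by (subst prod.remove) auto
  then have "poly D (p i) = 0" by simp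
  then show "poly Q (p i) = 0" using k0 by (simp add: DQ)
  have "poly (pderiv D) (p i) = poly D' (p i)"
    unfolding Di pderiv_mult poly_add poly_mult by (simp add: pderiv_pCons)
  moreover have "poly N (p i) = a i * poly D' (p i)"
  proof -
    have "poly N (p i) = (\<Sum>j\<in>?I. a j * (\<Prod>l\<in>?I - {j}. p i - p l))"
      by (simp add: N_def poly_sum poly_prod)
    \<comment> \<open>Every summand with \<open>j \<noteq> i\<close> contains the factor
      \<open>p i - p i\<close>.\<close>
    also have "\<dots> = (\<Sum>j\<in>{i}. a j * (\<Prod>l\<in>?I - {j}. p i - p l))"
      using i by (intro sum.mono_neutral_right) (auto intro!: prod_zero)
    finally show ?thesis by (simp add: D'_def poly_prod)
  qed
  ultimately have "k * (poly (pderiv Q) (p i) * a i) = k * poly P (p i)"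
    by (simp add: DQ NP pderiv_smult mult.commute)
  then show "poly (pderiv Q) (p i) * a i = poly P (p i)" using k0 by simp
qed

text \<open>On the left stands the growth constant at radius \<open>1 / r\<close>, times the
  \<open>r\<close> from rescaling a disc of radius \<open>r\<close>. Over the common denominator the
  numerator splits into two factors, compared with \<open>r\<^sup>2\<close> and
  \<open>r ^ 4\<close>.\<close>

lemma growth_constant_le:
  fixes r :: real
  assumes "1 < r"
  shows "r * ((1 / r + (1 / r) ^ 3 / 3) / (1 - 1 / r) ^ 3) \<le> r ^ 6 / ((r\<^sup>2 - 1) * (r - 1) ^ 4)"
proof -
  have r2: "0 < r\<^sup>2 - 1" using assms by (simp add: one_less_power)
  have "(1 - 1 / r) ^ 3 = (r - 1) ^ 3 / r ^ 3"
    using assms by (simp add: diff_divide_eq_iff power_divide)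
  moreover have "1 / r + (1 / r) ^ 3 / 3 = (r\<^sup>2 + 1 / 3) / r ^ 3"
    using assms by (simp add: field_simps power2_eq_square power3_eq_cube)
  ultimately have "r * ((1 / r + (1 / r) ^ 3 / 3) / (1 - 1 / r) ^ 3) = r * (r\<^sup>2 + 1 / 3) / (r - 1) ^ 3"
    using assms by simp
  also have "\<dots> = ((r - 1) * (r\<^sup>2 - 1)) * (r * (r\<^sup>2 + 1 / 3)) / (((r - 1) * (r\<^sup>2 - 1)) * (r - 1) ^ 3)"
    using mult_pos_pos[of "r - 1", OF _ r2] assms by (intro mult_divide_mult_cancel_left[symmetric]) linarith
  also have "\<dots> = (r * (r - 1)) * ((r\<^sup>2 + 1 / 3) * (r\<^sup>2 - 1)) / ((r\<^sup>2 - 1) * (r - 1) ^ 4)"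
    by (simp add: eval_nat_numeral mult_ac)
  also have "\<dots> \<le> r\<^sup>2 * r ^ 4 / ((r\<^sup>2 - 1) * (r - 1) ^ 4)"
  proof (intro divide_right_mono mult_mono)
    show "r * (r - 1) \<le> r\<^sup>2" using assms by (simp add: power2_eq_square algebra_simps)
    have "(r\<^sup>2 + 1 / 3) * (r\<^sup>2 - 1) \<le> (r\<^sup>2 + 1) * (r\<^sup>2 - 1)" using r2 by (intro mult_right_mono) auto
    also have "\<dots> \<le> r ^ 4" by (simp add: algebra_simps power2_eq_square eval_nat_numeral)
    finally show "(r\<^sup>2 + 1 / 3) * (r\<^sup>2 - 1) \<le> r ^ 4" .
  qed (use assms r2 in auto)
  finally show ?thesis by (simp flip: power_add)
qed

theorem theorem4p4:
  fixes d i :: nat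
    and a p :: "nat \<Rightarrow> complex"
    and R :: "complex option \<Rightarrow> complex option"
    and K V :: "complex option set"
    and r :: real
  assumes "good d R"
    and "\<And>z. z \<notin> p ` {1..d} \<Longrightarrow> R (Some z) = Some (\<Sum>j=1..d. a j / (z - p j))"
    and "i \<in> {1..d}"
    and "K = connected_component_of_set (subtopology ext_plane {x. ext_norm (R x) \<ge> 1}) (Some (p i))"
    and "r > 1"
    and "openin ext_plane V" and "K \<subseteq> V" and "inj_on R V"
    and "{x. ext_norm x \<ge> ereal (1 / r)} \<subseteq> R ` V"
  shows "log_capacity (Some -` K) \<le> r ^ 6 / ((r\<^sup>2 - 1) * (r - 1) ^ 4) * norm (a i)"
proof -
  obtain P Q where Q: "Q \<noteq> 0" and cop: "coprime P Q" and deg: "max (degree P) (degree Q) = d"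
    and R: "R = quotient_map_ext P Q"
    using assms(1) by (auto simp: good_def rational_of_degree_def)
  have R_None: "R None = Some 0" using assms(1) by (simp add: good_def)
  \<comment> \<open>A numerator of larger degree would give \<open>R None = None\<close>, so
    \<open>Q\<close> attains the maximum degree.\<close>
  have degQ: "degree Q = d"
  proof -
    have "\<not> degree P > degree Q" using R_None by (auto simp: R)
    then show ?thesis using deg by simp
  qed
  have pole: "poly Q (p i) = 0" "poly (pderiv Q) (p i) * a i = poly P (p i)"
  proof (atomize (full), intro conjI)
    have "poly P z / poly Q z = (\<Sum>j=1..d. a j / (z - p j))" if "z \<notin> p ` {1..d}" "poly Q z \<noteq> 0" for z
      using assms(2)[OF that(1)] that(2) by (simp add: R)
    from simple_pole_of_partial_fraction[OF cop degQ Q this assms(3)]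
    show "poly Q (p i) = 0" "poly (pderiv Q) (p i) * a i = poly P (p i)" by auto
  qed
  have cop_roots: "poly P z \<noteq> 0" if "poly Q z = 0" for z
    using coprime_poly_0[OF cop, of z] that by auto
  \<comment> \<open>The component of a point outside the space would be empty; the infinite norm at
    the pole puts \<open>p i\<close> into the space.\<close>
  have "R (Some (p i)) = None" using pole(1) by (simp add: R)
  then have "Some (p i) \<in> K"
    unfolding assms(4) by (simp add: connected_component_of_refl topspace_subtopology)
  then have piV: "Some (p i) \<in> V" using assms(7) by blast
  have K_sub: "1 \<le> ext_norm (R x)" if "x \<in> K" for x
    using that connected_component_of_subset_topspace[of "subtopology ext_plane {x. ext_norm (R x) \<ge> 1}" "Some (p i)"]
    unfolding assms(4) by (auto simp: topspace_subtopology)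
  \<comment> \<open>\<open>\<psi>\<close> is \<open>1 / R\<close> on the finite part of
    \<open>V\<close> without the zeros of \<open>R\<close>; poles of \<open>R\<close> become zeros
    of \<open>\<psi>\<close>.\<close>
  define W where "W = {z. Some z \<in> V \<and> poly P z \<noteq> 0}"
  define \<psi> where "\<psi> = (\<lambda>z. poly Q z / poly P z)"
  have "open (Some -` V)"
    using openin_continuous_map_preimage[OF continuous_map_Some assms(6)] by (simp add: vimage_def)
  then have "open W"
    unfolding W_def vimage_def Collect_conj_eq
    by (intro open_Int open_Collect_neq continuous_intros) auto
  have \<psi>_hol: "\<psi> holomorphic_on W"
    unfolding \<psi>_def W_def by (intro holomorphic_intros) auto
  have R_\<psi>: "R (Some z) = (if \<psi> z = 0 then None else Some (1 / \<psi> z))" if "z \<in> W" for z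
    using that by (auto simp: R \<psi>_def W_def)
  have \<psi>_inj: "inj_on \<psi> W"
  proof (rule inj_onI)
    fix z w assume "z \<in> W" "w \<in> W" "\<psi> z = \<psi> w"
    then have "R (Some z) = R (Some w)" "Some z \<in> V" "Some w \<in> V" by (auto simp: R_\<psi> W_def)
    then show "z = w" using assms(8) by (auto dest: inj_onD)
  qed
  have \<psi>_onto: "ball 0 r \<subseteq> \<psi> ` W"
  proof
    fix \<zeta> :: complex assume \<zeta>: "\<zeta> \<in> ball 0 r"
    show "\<zeta> \<in> \<psi> ` W"
    proof (cases "\<zeta> = 0")
      case True
      then show ?thesis using pole(1) piV cop_roots[of "p i"] by (auto simp: W_def \<psi>_def intro!: image_eqI[of _ _ "p i"])
    next
      case False
      then have "1 / r \<le> norm (1 / \<zeta>)"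
        using \<zeta> by (simp add: norm_divide frac_le)
      then have "Some (1 / \<zeta>) \<in> R ` V" using assms(9) by (intro subsetD[OF assms(9)]) simp
      then obtain x where x: "x \<in> V" "R x = Some (1 / \<zeta>)" by (metis imageE)
      \<comment> \<open>\<open>R\<close> vanishes at infinity while \<open>1 / \<zeta>\<close> is
        nonzero, so the preimage is a finite point.\<close>
      with R_None False obtain z where z: "x = Some z" by (cases x) auto
      then have "poly Q z \<noteq> 0" "poly P z / poly Q z = 1 / \<zeta>"
        using x by (auto simp: R split: if_splits)
      moreover from this have "poly P z \<noteq> 0" using False by auto
      ultimately have "z \<in> W" "\<psi> z = \<zeta>"
        using x z False by (auto simp: W_def \<psi>_def field_simps)
      then show ?thesis by blast
    qed
  qed
  obtain h where h: "h holomorphic_on \<psi> ` W" "\<And>z. z \<in> W \<Longrightarrow> deriv \<psi> z * deriv h (\<psi> z) = 1"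
      "\<And>z. z \<in> W \<Longrightarrow> h (\<psi> z) = z"
    using holomorphic_has_inverse[OF \<psi>_hol \<open>open W\<close> \<psi>_inj] by blast
  have pi_W: "p i \<in> W" "\<psi> (p i) = 0" using piV pole(1) cop_roots by (auto simp: W_def \<psi>_def)
  have "(\<psi> has_field_derivative poly (pderiv Q) (p i) / poly P (p i)) (at (p i))"
    unfolding \<psi>_def using pole(1) cop_roots[OF pole(1)]
    by (auto intro!: derivative_eq_intros poly_DERIV simp: power2_eq_square)
  then have "deriv \<psi> (p i) = poly (pderiv Q) (p i) / poly P (p i)" by (rule DERIV_imp_deriv)
  then have "a i * deriv \<psi> (p i) = 1"
    using pole(2) cop_roots[OF pole(1)] by (simp add: mult.commute)
  then have h'0: "deriv h 0 = a i" using h(2)[OF pi_W(1)] pi_W(2) by (metis mult.left_commute mult_1_right)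
  have h0: "h 0 = p i" using h(3)[OF pi_W(1)] pi_W(2) by simp
  have h_hol: "h holomorphic_on ball 0 r" using h(1) \<psi>_onto by (rule holomorphic_on_subset)
  have h_inj: "inj_on h (ball 0 r)"
    by (rule inj_on_inverseI[of _ \<psi>]) (use \<psi>_onto h(3) in auto)
  \<comment> \<open>The growth bound is stated on the unit disc. Rescaling multiplies the derivative
    at 0 by \<open>r\<close> and shrinks the closed unit disc, where \<open>\<psi>\<close> takes its
    values on the component, to radius \<open>1 / r\<close>.\<close>
  define f where "f = (\<lambda>z. h (of_real r * z))"
  have scale: "of_real r * z \<in> ball 0 r" if "z \<in> ball 0 1" for z :: complex
    using that assms(5) by (simp add: norm_mult)
  have f_hol: "f holomorphic_on ball 0 1"
    unfolding f_def using scale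
    by (intro holomorphic_on_compose_gen[of "\<lambda>z. of_real r * z" _ h "ball 0 r", unfolded o_def] h_hol) 
      (auto intro!: holomorphic_intros)
  have f_inj: "inj_on f (ball 0 1)"
  proof (rule inj_onI)
    fix z w :: complex assume "z \<in> ball 0 1" "w \<in> ball 0 1" "f z = f w"
    then have "of_real r * z = of_real r * w"
      unfolding f_def by (metis inj_onD[OF h_inj] scale)
    then show "z = w" using assms(5) by simp
  qed
  have f'0: "deriv f 0 = of_real r * a i"
  proof -
    have "(h has_field_derivative deriv h 0) (at (of_real r * 0))"
      using holomorphic_derivI[OF h_hol open_ball, of 0] assms(5) by simp
    then have "(f has_field_derivative deriv h 0 * of_real r) (at 0)"
      unfolding f_def by (rule DERIV_chain2) (auto intro!: derivative_eq_intros)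
    then show ?thesis by (simp add: DERIV_imp_deriv h'0)
  qed
  define \<rho> where "\<rho> = norm (deriv f 0) * ((1 / r + (1 / r) ^ 3 / 3) / (1 - 1 / r) ^ 3)"
  have "Some -` K \<subseteq> cball (p i) \<rho>"
  proof
    fix z assume "z \<in> Some -` K"
    then have z: "Some z \<in> V" "1 \<le> ext_norm (R (Some z))" using assms(7) K_sub by auto
    \<comment> \<open>By coprimality a zero of \<open>P\<close> is a zero of \<open>R\<close>, where
      the norm is below 1.\<close>
    have "poly P z \<noteq> 0" using z(2) cop_roots[of z] by (auto simp: R one_ereal_def split: if_splits)
    then have zW: "z \<in> W" using z by (simp add: W_def)
    have "norm (\<psi> z) \<le> 1"
      using z(2) unfolding R_\<psi>[OF zW] by (auto simp: one_ereal_def norm_divide divide_simps split: if_splits)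
    define w where "w = \<psi> z / of_real r"
    have w: "norm w \<le> 1 / r" using \<open>norm (\<psi> z) \<le> 1\<close> assms(5) by (simp add: w_def norm_divide divide_right_mono)
    have r1: "1 / r < 1" using assms(5) by simp
    have "f w = z" using h(3)[OF zW] assms(5) by (simp add: f_def w_def)
    moreover have "f 0 = p i" by (simp add: f_def h0)
    ultimately have "norm (z - p i) \<le> norm (deriv f 0) * ((norm w + norm w ^ 3 / 3) / (1 - norm w) ^ 3)"
      using univalent_growth[OF f_hol f_inj, of w] w r1 by simp
    also have "\<dots> \<le> \<rho>"
      unfolding \<rho>_def using w r1 assms(5) by (intro mult_left_mono frac_le add_mono power_mono divide_right_mono) auto
    finally show "z \<in> cball (p i) \<rho>" by (simp add: dist_norm norm_minus_commute)
  qed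
  moreover have "0 \<le> \<rho>" unfolding \<rho>_def using assms(5) by (intro mult_nonneg_nonneg divide_nonneg_nonneg) auto
  ultimately have "log_capacity (Some -` K) \<le> \<rho>" by (rule log_capacity_le_radius)
  also have "\<rho> = r * ((1 / r + (1 / r) ^ 3 / 3) / (1 - 1 / r) ^ 3) * norm (a i)"
    unfolding \<rho>_def f'0 using assms(5) by (simp add: norm_mult)
  also have "\<dots> \<le> r ^ 6 / ((r\<^sup>2 - 1) * (r - 1) ^ 4) * norm (a i)"
    by (intro mult_right_mono growth_constant_le assms(5)) auto
  finally show ?thesis .
qed

end
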